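(* Let $s\ge2$, $k\ge1$, $0\le t\le k$, $\lambda\ge1$ be integers and let $Y=\{\mathbf y\in[s]^k: d(\mathbf y,\mathbf 1)>t\}$. Then $\Pi(\mathrm{OAP}(k,s,t,\lambda))=H_{k,s,t}$, where $H_{k,s,t}$ is defined as follows: if $t=0$, $H_{k,s,t}$ is the group of all permutations of $Y$ ($\cong S_{s^k-1}$); if $0<t<k$ and ($k>t+1$ or $s>2$), $H_{k,s,t}$ is the group of permutations of $Y$ induced by the maps $[s]^k\to[s]^k$ that permute the $k$ coordinates and, independently in each coordinate, permute the levels $\{2,\dots,s\}$ while fixing level $1$ ($\cong S_{s-1}\wr S_k$); otherwise $H_{k,s,t}$ is the trivial group.
   Context: Let $\{a_c\}$ be defined by $a_0=\lambda$, $a_c=\lambda-\sum_{e=0}^{c-1}a_e\binom{k-t}{c-e}(s-1)^{c-e}$ for $c\ge1$. Write $[s]=\{1,\dots,s\}$, $\mathbf 1=(1,\dots,1)\in[s]^k$, and $d(\mathbf u,\mathbf v)$ for the Hamming distance on $[s]^k$. For $\mathbf x\in[s]^k$ let $I_{\mathbf x}=\{i:x_i\ne1\}$, $J_{\mathbf x}=\{\mathbf y\in[s]^k: y_i=x_i\ \forall i\in I_{\mathbf x}\}$. Let $m=|Y|$. The LP relaxation orthogonal array polytope $\mathrm{OAP}(k,s,t,\lambda)\subseteq\mathbb R^m$ is the set of real vectors $(N_{\mathbf y})_{\mathbf y\in Y}$ satisfying $N_{\mathbf y}\ge0$ for all $\mathbf y\in Y$ and, for every $\mathbf x\in[s]^k$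 with $0\le d(\mathbf 1,\mathbf x)\le t$, $a_{t-d(\mathbf 1,\mathbf x)}+(-1)^{t-d(\mathbf 1,\mathbf x)+1}\sum_{\mathbf y\in J_{\mathbf x}\cap Y}\binom{d(\mathbf 1,\mathbf y)-d(\mathbf 1,\mathbf x)-1}{t-d(\mathbf 1,\mathbf x)}N_{\mathbf y}\ge0$. For a full-dimensional polytope $P\subseteq\mathbb R^m$, $\Pi(P)$ denotes the group of all permutations of the coordinates of $\mathbb R^m$ (here identified with permutations of $Y$, acting by $N_{\mathbf y}\mapsto N_{\sigma(\mathbf y)}$) that map $P$ onto itself. *)

theory Defs
  imports "HOL-Algebra.Sym_Groups" "HOL-Library.FuncSet" Complex_Main
begin

text \<open>The set \<open>[s]^k\<close> is rendered as the extensional functions from \<open>{1..k}\<close> to \<open>{1..s}\<close>.\<close>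

definition words :: "nat \<Rightarrow> nat \<Rightarrow> (nat \<Rightarrow> nat) set" where
  "words k s = {1..k} \<rightarrow>\<^sub>E {1..s}"

definition ones :: "nat \<Rightarrow> nat \<Rightarrow> nat" where
  "ones k = (\<lambda>i\<in>{1..k}. 1)"

definition hdist :: "nat \<Rightarrow> (nat \<Rightarrow> nat) \<Rightarrow> (nat \<Rightarrow> nat) \<Rightarrow> nat" where
  "hdist k u v = card {i \<in> {1..k}. u i \<noteq> v i}"

definition I_set :: "nat \<Rightarrow> (nat \<Rightarrow> nat) \<Rightarrow> nat set" where
  "I_set k x = {i \<in> {1..k}. x i \<noteq> 1}"

definition J_set :: "nat \<Rightarrow> nat \<Rightarrow> (nat \<Rightarrow> nat) \<Rightarrow> (nat \<Rightarrow> nat) set" where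
  "J_set k s x = {y \<in> words k s. \<forall>i \<in> I_set k x. y i = x i}"

definition Y_set :: "nat \<Rightarrow> nat \<Rightarrow> nat \<Rightarrow> (nat \<Rightarrow> nat) set" where
  "Y_set k s t = {y \<in> words k s. hdist k y (ones k) > t}"

text \<open>At \<open>c = 0\<close> the sum is empty, so the initial value is \<open>lam\<close>.\<close>

fun oa_coeff :: "nat \<Rightarrow> nat \<Rightarrow> nat \<Rightarrow> int \<Rightarrow> nat \<Rightarrow> int" where
  "oa_coeff k s t lam c =
     lam - (\<Sum>e<c. oa_coeff k s t lam e * int ((k - t) choose (c - e)) * (int s - 1) ^ (c - e))"

declare oa_coeff.simps [simp del]

text \<open>
  Vectors with real coordinates indexed by \<open>Y\<close> are the functions in \<open>extensional Y\<close>.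
  The natural-number subtractions below never truncate: the constraints are only imposed for
  \<open>hdist k (ones k) x \<le> t\<close>, while \<open>hdist k (ones k) y > t\<close> on \<open>Y\<close>.
\<close>

definition OAP :: "nat \<Rightarrow> nat \<Rightarrow> nat \<Rightarrow> int \<Rightarrow> ((nat \<Rightarrow> nat) \<Rightarrow> real) set" where
  "OAP k s t lam =
     {N \<in> extensional (Y_set k s t).
        (\<forall>y \<in> Y_set k s t. 0 \<le> N y) \<and>
        (\<forall>x \<in> words k s. hdist k (ones k) x \<le> t \<longrightarrow>
           0 \<le> of_int (oa_coeff k s t lam (t - hdist k (ones k) x))
             + (- 1) ^ (t - hdist k (ones k) x + 1) *
               (\<Sum>y \<in> J_set k s x \<inter> Y_set k s t.
                  of_nat ((hdist k (ones k) y - hdist k (ones k) x - 1)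
                            choose (t - hdist k (ones k) x)) * N y))}"

text \<open>
  Coordinate permutations preserving \<open>P\<close>. A map that permutes \<open>Y\<close> is the identity
  outside \<open>Y\<close>, so \<open>N \<circ> \<sigma>\<close> is again extensional.
\<close>

definition coord_symmetries :: "'a set \<Rightarrow> ('a \<Rightarrow> real) set \<Rightarrow> ('a \<Rightarrow> 'a) set" where
  "coord_symmetries Y P = {\<sigma>. \<sigma> permutes Y \<and> (\<lambda>N. N \<circ> \<sigma>) ` P = P}"

text \<open>The map on \<open>[s]^k\<close> given by a coordinate permutation \<open>\<pi>\<close> and level permutations \<open>g i\<close>.\<close>

definition word_map :: "nat \<Rightarrow> (nat \<Rightarrow> nat \<Rightarrow> nat) \<Rightarrow> (nat \<Rightarrow> nat) \<Rightarrow> (nat \<Rightarrow> nat) \<Rightarrow> nat \<Rightarrow> nat" where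
  "word_map k g \<pi> x = (\<lambda>i\<in>{1..k}. g i (x (\<pi> i)))"

definition induced_perms :: "nat \<Rightarrow> nat \<Rightarrow> nat \<Rightarrow> ((nat \<Rightarrow> nat) \<Rightarrow> nat \<Rightarrow> nat) set" where
  "induced_perms k s t =
     {\<sigma>. \<exists>\<pi> g. \<pi> permutes {1..k} \<and> (\<forall>i \<in> {1..k}. g i permutes {2..s}) \<and>
              \<sigma> = (\<lambda>y. if y \<in> Y_set k s t then word_map k g \<pi> y else y)}"

definition H_perms :: "nat \<Rightarrow> nat \<Rightarrow> nat \<Rightarrow> ((nat \<Rightarrow> nat) \<Rightarrow> nat \<Rightarrow> nat) set" where
  "H_perms k s t =
     (if t = 0 then {\<sigma>. \<sigma> permutes Y_set k s t}
      else if t < k \<and> (k > t + 1 \<or> s > 2) then induced_perms k s t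
      else {id})"

definition perm_group :: "('a \<Rightarrow> 'a) set \<Rightarrow> ('a \<Rightarrow> 'a) monoid" where
  "perm_group A = \<lparr>carrier = A, mult = (\<circ>), one = id\<rparr>"

text \<open>
  The wreath product \<open>G wr S\<^sub>k\<close>, i.e. \<open>G^k\<close> extended by \<open>S\<^sub>k\<close> permuting the factors. The
  inverse makes this the left action of \<open>S\<^sub>k\<close>, matching the composition order of \<open>sym_group\<close>.
\<close>

definition wreath_sym :: "('a, 'b) monoid_scheme \<Rightarrow> nat \<Rightarrow> ((nat \<Rightarrow> 'a) \<times> (nat \<Rightarrow> nat)) monoid" where
  "wreath_sym G k =
     \<lparr>carrier = ({1..k} \<rightarrow>\<^sub>E carrier G) \<times> carrier (sym_group k),
      mult = (\<lambda>(g, \<pi>) (h, \<rho>).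
        ((\<lambda>i\<in>{1..k}. g i \<otimes>\<^bsub>G\<^esub> h (Hilbert_Choice.inv \<pi> i)), \<pi> \<circ> \<rho>)),
      one = ((\<lambda>i\<in>{1..k}. \<one>\<^bsub>G\<^esub>), id)\<rparr>"

end

theory Submission
  imports Defs "HOL-Computational_Algebra.Formal_Power_Series"
begin

text \<open>
  The constraint of a word \<open>x\<close> says that the frequency of \<open>x\<close> in a (fractional) orthogonal array
  with frequencies \<open>N\<close> on \<open>Y\<close> is nonnegative. Perturbing the uniform array in a direction with
  vanishing \<open>t\<close>-dimensional marginals gives points of the polytope where a single prescribed
  constraint is tight, so these constraints are facets and a symmetry permutes facets up to
  positive scaling. The constraints of words \<open>x\<close> of weight \<open>t\<close> are recognised by their constant
  coefficients (if \<open>k > t + 1\<close>) or by the number of their nonzero coefficients (if \<open>k = t + 1\<close>),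
  so a symmetry permutes the blocks \<open>J_set k s x \<inter> Y\<close>, \<open>x\<close> of weight \<open>t\<close>. Counting the blocks
  containing two given words shows that it preserves weights and, on the words of weight \<open>k\<close>,
  adjacency in the Hamming graph, whose automorphisms are the maps \<open>word_map\<close>; for \<open>s = 2\<close> the
  words of weight \<open>k - 1\<close> take over this role. The values on these words determine the symmetry.
\<close>

section \<open>Frequencies of orthogonal arrays\<close>

text \<open>The inequalities \<open>0 \<le> N y\<close> are permuted among themselves by any
  permutation of \<open>Y_set\<close>, and the tight points used are strictly positive there, so
  only inequalities of \<open>low_words\<close> have to be followed. A priori a symmetry could send
  the inequality of a word of weight \<open>t\<close> to that of a word of smaller weight. Weight
  \<open>t\<close> is singled out because its coefficient vector is minus an indicator function, so
  the whole inequality is encoded by a set. What remains is a problem about a set system that does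
  not depend on \<open>lam\<close>. Two words lie in \<open>n choose t\<close> common blocks, where
  \<open>n\<close> counts the positions at which they agree in a level other than 1. This number
  determines \<open>n\<close> only when it is nonzero, that is for \<open>n \<ge> t\<close>, so
  Hamming distances of words far apart cannot be read off. Weights (more than \<open>t\<close>
  positions) and adjacency of full words (\<open>k - 1 \<ge> t\<close> positions) can, and this is
  why the reconstruction goes through the Hamming graph rather than its metric.\<close>

lemma hdist_ones [simp]:
  "hdist k y (ones k) = card (I_set k y)" "hdist k (ones k) y = card (I_set k y)"
proof -
  have "{i \<in> {1..k}. y i \<noteq> ones k i} = I_set k y" "{i \<in> {1..k}. ones k i \<noteq> y i} = I_set k y"
    by (auto simp: I_set_def ones_def)
  then show "hdist k y (ones k) = card (I_set k y)" "hdist k (ones k) y = card (I_set k y)"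
    by (simp_all only: hdist_def)
qed

lemma I_set_subset: "I_set k x \<subseteq> {1..k}"
  by (auto simp: I_set_def)

lemma finite_I_set [simp, intro]: "finite (I_set k x)"
  by (rule finite_subset[OF I_set_subset]) simp

lemma card_I_set_le: "card (I_set k x) \<le> k"
  using card_mono[OF _ I_set_subset, of k x] by simp

lemma finite_words [simp, intro]: "finite (words k s)"
  by (simp add: words_def finite_PiE)

lemma Y_set_eq: "Y_set k s t = {y \<in> words k s. t < card (I_set k y)}"
  by (simp add: Y_set_def)

lemma finite_Y_set [simp, intro]: "finite (Y_set k s t)"
  by (simp add: Y_set_eq)

lemma words_eqI:
  assumes "x \<in> words k s" "y \<in> words k s" "\<And>i. i \<in> {1..k} \<Longrightarrow> x i = y i"
  shows "x = y"
  using assms unfolding words_def by (rule PiE_ext)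

lemma words_in: "x \<in> words k s \<Longrightarrow> i \<in> {1..k} \<Longrightarrow> x i \<in> {1..s}"
  unfolding words_def by (rule PiE_mem)

lemma words_out: "x \<in> words k s \<Longrightarrow> i \<notin> {1..k} \<Longrightarrow> x i = undefined"
  unfolding words_def by (rule PiE_arb)

lemma wordsI:
  "(\<And>i. i \<in> {1..k} \<Longrightarrow> x i \<in> {1..s}) \<Longrightarrow> (\<And>i. i \<notin> {1..k} \<Longrightarrow> x i = undefined) \<Longrightarrow> x \<in> words k s"
  unfolding words_def by (rule PiE_I)

definition low_words :: "nat \<Rightarrow> nat \<Rightarrow> nat \<Rightarrow> (nat \<Rightarrow> nat) set" where
  "low_words k s t = {x \<in> words k s. card (I_set k x) \<le> t}"

definition oa_const :: "nat \<Rightarrow> nat \<Rightarrow> nat \<Rightarrow> int \<Rightarrow> (nat \<Rightarrow> nat) \<Rightarrow> real" where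
  "oa_const k s t lam x = of_int (oa_coeff k s t lam (t - card (I_set k x)))"

text \<open>The coefficient is extended by zero outside \<open>J_set k s x\<close>, so that all
  constraints are linear forms over the same index set \<open>Y_set\<close>.\<close>

definition oa_weight :: "nat \<Rightarrow> nat \<Rightarrow> nat \<Rightarrow> (nat \<Rightarrow> nat) \<Rightarrow> (nat \<Rightarrow> nat) \<Rightarrow> real" where
  "oa_weight k s t x y =
     (if y \<in> J_set k s x
      then (- 1) ^ (t - card (I_set k x) + 1) *
           of_nat ((card (I_set k y) - card (I_set k x) - 1) choose (t - card (I_set k x)))
      else 0)"

lemma finite_low_words [simp, intro]: "finite (low_words k s t)"
  by (simp add: low_words_def)

lemma OAP_eq:
  "OAP k s t lam =
     {N \<in> extensional (Y_set k s t). (\<forall>y \<in> Y_set k s t. 0 \<le> N y) \<and>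
        (\<forall>x \<in> low_words k s t.
           0 \<le> oa_const k s t lam x + (\<Sum>y\<in>Y_set k s t. oa_weight k s t x y * N y))}"
proof -
  have "(- 1) ^ (t - card (I_set k x) + 1) *
          (\<Sum>y \<in> J_set k s x \<inter> Y_set k s t.
             of_nat ((card (I_set k y) - card (I_set k x) - 1) choose (t - card (I_set k x))) * N y)
        = (\<Sum>y\<in>Y_set k s t. oa_weight k s t x y * N y)" for x and N :: "(nat \<Rightarrow> nat) \<Rightarrow> real"
    unfolding sum_distrib_left
    by (rule sum.mono_neutral_cong_left) (auto simp: oa_weight_def)
  then show ?thesis
    unfolding OAP_def hdist_ones oa_const_def low_words_def by auto
qed

lemma sum_Pow_card_le:
  fixes g :: "nat \<Rightarrow> 'a :: semiring_1"
  assumes "finite A"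
  shows "(\<Sum>E | E \<subseteq> A \<and> card E \<le> c. g (card E)) = (\<Sum>e\<le>c. of_nat (card A choose e) * g e)"
proof -
  have "(\<Sum>E | E \<subseteq> A \<and> card E \<le> c. g (card E))
      = (\<Sum>e\<le>c. \<Sum>E | E \<in> {E. E \<subseteq> A \<and> card E \<le> c} \<and> card E = e. g (card E))"
    using assms by (intro sum.group [symmetric]) auto
  also have "\<dots> = (\<Sum>e\<le>c. of_nat (card {E. E \<subseteq> A \<and> card E = e}) * g e)"
  proof (rule sum.cong [OF refl])
    fix e assume "e \<in> {..c}"
    then have "{E. E \<in> {E. E \<subseteq> A \<and> card E \<le> c} \<and> card E = e} = {E. E \<subseteq> A \<and> card E = e}" by auto
    then show "(\<Sum>E | E \<in> {E. E \<subseteq> A \<and> card E \<le> c} \<and> card E = e. g (card E))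
        = of_nat (card {E. E \<subseteq> A \<and> card E = e}) * g e" by simp
  qed
  finally show ?thesis by (simp add: n_subsets assms)
qed

text \<open>Upper negation turns the signed factor into \<open>(c - n) gchoose (c - e)\<close>, and
  Vandermonde then evaluates the sum as \<open>(c - (n - q)) choose c\<close>. The upper entry is a
  natural number at most \<open>c\<close> and reaches \<open>c\<close> only for
  \<open>q = n\<close>.\<close>

lemma alternating_binomial_sum:
  assumes "q \<le> n" "n - q \<le> c" "c < n"
  shows "(\<Sum>e\<le>c. of_nat (q choose e) * ((- 1) ^ (c - e) * of_nat ((n - e - 1) choose (c - e))))
       = (if q = n then 1 else 0 :: real)"
proof -
  have "(\<Sum>e\<le>c. of_nat (q choose e) * ((- 1) ^ (c - e) * of_nat ((n - e - 1) choose (c - e))))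
      = (\<Sum>e\<in>{0..c}. (real q gchoose e) * ((real c - real n) gchoose (c - e)))"
  proof (rule sum.cong)
    fix e assume e: "e \<in> {0..c}"
    have "(real c - real n) gchoose (c - e)
        = (- 1) ^ (c - e) * ((real (c - e) - (real c - real n) - 1) gchoose (c - e))"
      by (rule gbinomial_negated_upper)
    also have "real (c - e) - (real c - real n) - 1 = real (n - e - 1)"
      using e assms by (simp add: of_nat_diff)
    finally show "of_nat (q choose e) * ((- 1) ^ (c - e) * of_nat ((n - e - 1) choose (c - e)))
        = (real q gchoose e) * ((real c - real n) gchoose (c - e))"
      by (simp add: binomial_gbinomial)
  qed auto
  also have "\<dots> = (real q + (real c - real n)) gchoose c"
    by (rule gbinomial_Vandermonde)
  also have "real q + (real c - real n) = real (c - (n - q))"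
    using assms by (simp add: of_nat_diff)
  also have "\<dots> gchoose c = real ((c - (n - q)) choose c)"
    by (simp add: binomial_gbinomial)
  also have "\<dots> = (if q = n then 1 else 0)"
    using assms by auto
  finally show ?thesis .
qed

section \<open>Cylinders: words that agree with \<open>x\<close> on a coordinate set
  \<open>T\<close> containing its support\<close>

context
  fixes k s t :: nat and x :: "nat \<Rightarrow> nat" and T :: "nat set"
  assumes T: "T \<subseteq> {1..k}" "I_set k x \<subseteq> T" and x: "x \<in> words k s" and s: "1 \<le> s"
begin

lemma cylinder_support:
  assumes "z \<in> words k s" "\<forall>i\<in>T. z i = x i"
  shows "I_set k z \<inter> T = I_set k x" "card (I_set k z) = card (I_set k x) + card (I_set k z - T)"
    "J_set k s z \<subseteq> J_set k s x" "z \<in> J_set k s x"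
proof -
  show 1: "I_set k z \<inter> T = I_set k x"
    using T assms by (auto simp: I_set_def)
  show "card (I_set k z) = card (I_set k x) + card (I_set k z - T)"
    using card_Int_Diff[of "I_set k z" T] 1 by simp
  have "i \<in> I_set k z \<and> z i = x i" if "i \<in> I_set k x" for i
    using 1 assms T that by blast
  then show "J_set k s z \<subseteq> J_set k s x" "z \<in> J_set k s x"
    using assms(1) unfolding J_set_def by auto
qed

lemma card_cylinder_support:
  assumes "E \<subseteq> {1..k} - T"
  shows "card {z \<in> words k s. (\<forall>i\<in>T. z i = x i) \<and> I_set k z - T = E} = (s - 1) ^ card E"
proof -
  let ?B = "\<lambda>i. if i \<in> T then {x i} else if i \<in> E then {2..s} else {1}"
  have "{z \<in> words k s. (\<forall>i\<in>T. z i = x i) \<and> I_set k z - T = E} = PiE {1..k} ?B"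
  proof (intro equalityI subsetI)
    fix z assume z: "z \<in> {z \<in> words k s. (\<forall>i\<in>T. z i = x i) \<and> I_set k z - T = E}"
    show "z \<in> PiE {1..k} ?B"
    proof (rule PiE_I)
      fix i assume i: "i \<in> {1..k}"
      have "z i \<in> {1..s}" using z i words_in by blast
      then show "z i \<in> ?B i" using z i by (auto simp: I_set_def)
    qed (use z words_out in blast)
  next
    fix z assume z: "z \<in> PiE {1..k} ?B"
    have zi: "z i \<in> ?B i" if "i \<in> {1..k}" for i using z that by blast
    have "z \<in> words k s"
    proof (rule wordsI)
      fix i assume i: "i \<in> {1..k}"
      show "z i \<in> {1..s}" using zi[OF i] words_in[OF x i] s by (simp split: if_splits)
    qed (rule PiE_arb[OF z])
    moreover have "\<forall>i\<in>T. z i = x i"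
    proof
      fix i assume i: "i \<in> T"
      then have "i \<in> {1..k}" using T(1) by blast
      from zi[OF this] show "z i = x i" using i by simp
    qed
    moreover have "I_set k z - T = E"
    proof (intro equalityI subsetI)
      fix i assume "i \<in> I_set k z - T"
      then have "i \<in> {1..k}" "z i \<noteq> 1" "i \<notin> T" by (auto simp: I_set_def)
      then show "i \<in> E" using zi[of i] by (simp split: if_splits)
    next
      fix i assume i: "i \<in> E"
      then have i': "i \<in> {1..k}" "i \<notin> T" using assms by auto
      then have "z i \<in> {2..s}" using zi[of i] i by simp
      then show "i \<in> I_set k z - T" using i' by (simp add: I_set_def)
    qed
    ultimately show "z \<in> {z \<in> words k s. (\<forall>i\<in>T. z i = x i) \<and> I_set k z - T = E}" by blast
  qed
  then have "card {z \<in> words k s. (\<forall>i\<in>T. z i = x i) \<and> I_set k z - T = E}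
      = (\<Prod>i\<in>{1..k}. card (?B i))" by (simp add: card_PiE)
  also have "\<dots> = (\<Prod>i\<in>{1..k}. if i \<in> E then s - 1 else 1)"
    using assms by (intro prod.cong) auto
  also have "\<dots> = (\<Prod>i\<in>E. s - 1)"
    using assms by (intro prod.mono_neutral_cong_right) auto
  finally show ?thesis by simp
qed

text \<open>This is the recursion for \<open>oa_coeff\<close> read combinatorially. There are
  \<open>k - t\<close> coordinates outside \<open>T\<close>, so \<open>(k - t) choose e\<close>
  times \<open>(s - 1) ^ e\<close> words of the cylinder have \<open>e\<close> entries other than 1
  outside \<open>T\<close>, and each of them carries the constant of index
  \<open>c - e\<close>.\<close>

lemma sum_oa_coeff_cylinder:
  assumes "card T = t"
  shows "(\<Sum>z | z \<in> low_words k s t \<and> (\<forall>i\<in>T. z i = x i). oa_const k s t lam z) = of_int lam"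
proof -
  define c where "c = t - card (I_set k x)"
  have le: "card (I_set k x) \<le> t"
    using card_mono[OF _ T(2)] assms finite_subset[OF T(1)] by simp
  define Z where "Z = {z. z \<in> low_words k s t \<and> (\<forall>i\<in>T. z i = x i)}"
  define g where "g = (\<lambda>e. (oa_coeff k s t lam (c - e)) :: int)"
  have fin: "finite {E. E \<subseteq> {1..k} - T \<and> card E \<le> c}" by simp
  have Zw: "card (I_set k z) = card (I_set k x) + card (I_set k z - T)" if "z \<in> Z" for z
    using that cylinder_support(2) by (auto simp: Z_def low_words_def)
  have "(\<Sum>z\<in>Z. oa_coeff k s t lam (t - card (I_set k z))) = (\<Sum>z\<in>Z. g (card (I_set k z - T)))"
    using Zw by (intro sum.cong) (simp_all add: g_def c_def)
  also have "\<dots> = (\<Sum>E | E \<subseteq> {1..k} - T \<and> card E \<le> c.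
      \<Sum>z | z \<in> Z \<and> I_set k z - T = E. g (card (I_set k z - T)))"
  proof (rule sum.group [symmetric])
    show "finite Z" by (simp add: Z_def)
    show "(\<lambda>z. I_set k z - T) ` Z \<subseteq> {E. E \<subseteq> {1..k} - T \<and> card E \<le> c}"
      using Zw I_set_subset by (fastforce simp: Z_def low_words_def c_def)
  qed (rule fin)
  also have "\<dots> = (\<Sum>E | E \<subseteq> {1..k} - T \<and> card E \<le> c. int ((s - 1) ^ card E) * g (card E))"
  proof (rule sum.cong [OF refl])
    fix E assume E: "E \<in> {E. E \<subseteq> {1..k} - T \<and> card E \<le> c}"
    have "{z. z \<in> Z \<and> I_set k z - T = E}
        = {z \<in> words k s. (\<forall>i\<in>T. z i = x i) \<and> I_set k z - T = E}"
      using E le cylinder_support(2) by (auto simp: Z_def low_words_def c_def)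
    then show "(\<Sum>z | z \<in> Z \<and> I_set k z - T = E. g (card (I_set k z - T)))
        = int ((s - 1) ^ card E) * g (card E)"
      using card_cylinder_support[of E] E by simp
  qed
  also have "\<dots> = (\<Sum>e\<le>c. int (card ({1..k} - T) choose e) * (int ((s - 1) ^ e) * g e))"
    by (rule sum_Pow_card_le) simp
  also have "\<dots> = (\<Sum>e\<le>c. oa_coeff k s t lam e * int ((k - t) choose (c - e)) * (int s - 1) ^ (c - e))"
  proof (rule sum.reindex_bij_witness[of _ "\<lambda>e. c - e" "\<lambda>e. c - e"])
    fix e assume "e \<in> {..c}"
    then show "oa_coeff k s t lam (c - e) * int ((k - t) choose (c - (c - e))) * (int s - 1) ^ (c - (c - e))
      = int (card ({1..k} - T) choose e) * (int ((s - 1) ^ e) * g e)"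
      using assms T s by (simp add: g_def card_Diff_subset finite_subset[OF T(1)] of_nat_diff)
  qed auto
  also have "\<dots> = oa_coeff k s t lam c
      + (\<Sum>e<c. oa_coeff k s t lam e * int ((k - t) choose (c - e)) * (int s - 1) ^ (c - e))"
    by (simp add: lessThan_Suc_atMost[symmetric])
  also have "\<dots> = lam"
    by (subst oa_coeff.simps) simp
  finally have "(\<Sum>z\<in>Z. oa_coeff k s t lam (t - card (I_set k z))) = lam" .
  then show ?thesis
    unfolding oa_const_def Z_def by (simp flip: of_int_sum)
qed

text \<open>Only the words \<open>z\<close> with \<open>y \<in> J_set k s z\<close> contribute. They
  correspond to subsets \<open>E\<close> of \<open>I_set k y - T\<close>, and their coefficient
  depends on \<open>card E\<close> alone, so the sum is minus the one in
  \<open>alternating_binomial_sum\<close>. There \<open>q = n\<close> says that on \<open>T\<close>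
  the word \<open>y\<close> has no entries other than 1 besides those of \<open>x\<close>.\<close>

lemma sum_oa_weight_cylinder:
  assumes "card T = t" "y \<in> Y_set k s t"
  shows "(\<Sum>z | z \<in> low_words k s t \<and> (\<forall>i\<in>T. z i = x i). oa_weight k s t z y)
       = (if \<forall>i\<in>T. y i = x i then - 1 else 0)"
proof (cases "y \<in> J_set k s x")
  case False
  have "oa_weight k s t z y = 0" if "z \<in> low_words k s t" "\<forall>i\<in>T. z i = x i" for z
    using False cylinder_support(3)[of z] that by (auto simp: low_words_def oa_weight_def)
  moreover have "\<not> (\<forall>i\<in>T. y i = x i)"
    using False cylinder_support(4)[of y] assms by (auto simp: Y_set_eq)
  ultimately show ?thesis by simp
next
  case True
  define c where "c = t - card (I_set k x)"
  define q where "q = card (I_set k y - T)"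
  define n where "n = card (I_set k y) - card (I_set k x)"
  have finT: "finite T" by (rule finite_subset[OF T(1)]) simp
  have le: "card (I_set k x) \<le> t"
    using card_mono[OF finT T(2)] assms by simp
  have yw: "y \<in> words k s" and yt: "t < card (I_set k y)" using assms by (auto simp: Y_set_eq)
  have xy: "y i = x i" if "i \<in> I_set k x" for i using True that by (simp add: J_set_def)
  have xsub: "I_set k x \<subseteq> I_set k y \<inter> T" using T(2) xy by (auto simp: I_set_def)
  have card_y: "card (I_set k y) = card (I_set k y \<inter> T) + q"
    using card_Int_Diff[of "I_set k y" T] by (simp add: q_def)
  have "card (I_set k y \<inter> T) \<le> t" using card_mono[OF finT, of "I_set k y \<inter> T"] assms by simp
  moreover have "card (I_set k x) \<le> card (I_set k y \<inter> T)" using xsub by (intro card_mono) auto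
  ultimately have qn: "q \<le> n" "n - q \<le> c" "c < n"
    using card_y yt le by (auto simp: n_def c_def)
  have q_eq: "q = n \<longleftrightarrow> (\<forall>i\<in>T. y i = x i)"
  proof
    assume "q = n"
    then have "card (I_set k y \<inter> T) = card (I_set k x)"
      using card_y qn yt le by (auto simp: n_def)
    then have eq: "I_set k y \<inter> T = I_set k x"
      using card_subset_eq[OF _ xsub] by simp
    show "\<forall>i\<in>T. y i = x i"
    proof
      fix i assume i: "i \<in> T"
      show "y i = x i"
      proof (cases "i \<in> I_set k x")
        case False
        then have "i \<notin> I_set k y" using eq i by blast
        then show ?thesis using False i T(1) by (auto simp: I_set_def)
      qed (use xy in blast)
    qed
  next
    assume "\<forall>i\<in>T. y i = x i"
    then show "q = n" using cylinder_support(2)[OF yw] by (simp add: q_def n_def)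
  qed
  define h where "h = (\<lambda>e. - ((- 1) ^ (c - e) * real ((n - e - 1) choose (c - e))))"
  \<comment> \<open>Inverse of \<open>z \<mapsto> I_set k z - T\<close>: a contributing word copies
    \<open>x\<close> on \<open>T\<close>, copies \<open>y\<close> on \<open>E\<close> and is 1
    elsewhere.\<close>
  define ext where "ext = (\<lambda>E. \<lambda>i\<in>{1..k}. if i \<in> T then x i else if i \<in> E then y i else 1)"
  have ext: "ext E \<in> words k s" "\<forall>i\<in>T. ext E i = x i" "I_set k (ext E) - T = E"
    "y \<in> J_set k s (ext E)"
    if "E \<subseteq> I_set k y - T" for E
  proof -
    show "ext E \<in> words k s"
      using words_in[OF x] words_in[OF yw] s by (intro wordsI) (auto simp: ext_def)
    show "\<forall>i\<in>T. ext E i = x i" using T(1) by (auto simp: ext_def)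
    show "I_set k (ext E) - T = E" using that by (auto simp: ext_def I_set_def)
    have "y i = ext E i" if "i \<in> I_set k (ext E)" for i
      using that xy[of i] by (auto simp: ext_def I_set_def split: if_splits)
    then show "y \<in> J_set k s (ext E)" using yw by (simp add: J_set_def)
  qed
  have "(\<Sum>z | z \<in> low_words k s t \<and> (\<forall>i\<in>T. z i = x i). oa_weight k s t z y)
      = (\<Sum>z | z \<in> low_words k s t \<and> (\<forall>i\<in>T. z i = x i) \<and> y \<in> J_set k s z. oa_weight k s t z y)"
    by (rule sum.mono_neutral_right) (auto simp: oa_weight_def)
  also have "\<dots> = (\<Sum>E | E \<subseteq> I_set k y - T \<and> card E \<le> c. h (card E))"
  proof (rule sum.reindex_bij_witness[of _ ext "\<lambda>z. I_set k z - T"])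
    fix z assume z: "z \<in> {z. z \<in> low_words k s t \<and> (\<forall>i\<in>T. z i = x i) \<and> y \<in> J_set k s z}"
    then have zw: "z \<in> words k s" and zT: "\<forall>i\<in>T. z i = x i" and yz: "\<And>i. i \<in> I_set k z \<Longrightarrow> y i = z i"
      and zt: "card (I_set k z) \<le> t"
      by (auto simp: low_words_def J_set_def)
    show "ext (I_set k z - T) = z"
    proof (rule words_eqI[OF _ zw])
      show "ext (I_set k z - T) \<in> words k s"
        using words_in[OF x] words_in[OF yw] s by (intro wordsI) (auto simp: ext_def)
      fix i assume i: "i \<in> {1..k}"
      then show "ext (I_set k z - T) i = z i"
        using zT yz by (auto simp: ext_def I_set_def)
    qed
    have sub: "I_set k z - T \<subseteq> I_set k y - T" using yz by (auto simp: I_set_def)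
    have cz: "card (I_set k z) = card (I_set k x) + card (I_set k z - T)"
      by (rule cylinder_support(2)[OF zw zT])
    show "I_set k z - T \<in> {E. E \<subseteq> I_set k y - T \<and> card E \<le> c}"
      using sub cz zt by (simp add: c_def)
    show "h (card (I_set k z - T)) = oa_weight k s t z y"
      using z cz by (simp add: h_def oa_weight_def c_def n_def)
  next
    fix E assume E: "E \<in> {E. E \<subseteq> I_set k y - T \<and> card E \<le> c}"
    show "I_set k (ext E) - T = E" using ext E by blast
    show "ext E \<in> {z. z \<in> low_words k s t \<and> (\<forall>i\<in>T. z i = x i) \<and> y \<in> J_set k s z}"
      using E ext[of E] cylinder_support(2)[of "ext E"] le by (auto simp: low_words_def c_def)
  qed
  also have "\<dots> = (\<Sum>e\<le>c. of_nat (q choose e) * h e)"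
    unfolding q_def by (rule sum_Pow_card_le) simp
  also have "\<dots> = - (\<Sum>e\<le>c. of_nat (q choose e) *
      ((- 1) ^ (c - e) * of_nat ((n - e - 1) choose (c - e))))"
    by (simp add: h_def sum_negf)
  also have "\<dots> = (if q = n then - 1 else 0)"
    using alternating_binomial_sum[OF qn] by simp
  finally show ?thesis using q_eq by simp
qed

end

text \<open>The marginal equations form a triangular system, solved from weight \<open>t\<close>
  downwards. For a \<open>t\<close>-set \<open>T\<close> containing the support of \<open>x\<close>,
  the two sides have equal sums over the low words of the cylinder: by the cylinder lemmas both sums
  are \<open>lam\<close> minus the mass of the cylinder in \<open>Y_set\<close>. Every other low
  word of the cylinder has larger weight than \<open>x\<close>, so the induction hypothesis cancels
  it.\<close>

theorem oa_frequency_eq: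
  fixes M :: "(nat \<Rightarrow> nat) \<Rightarrow> real"
  assumes marginals: "\<And>T x. T \<subseteq> {1..k} \<Longrightarrow> card T = t \<Longrightarrow> x \<in> words k s \<Longrightarrow>
      (\<Sum>z | z \<in> words k s \<and> (\<forall>i\<in>T. z i = x i). M z) = of_int lam"
    and "t \<le> k" "1 \<le> s" "x \<in> low_words k s t"
  shows "M x = oa_const k s t lam x + (\<Sum>y\<in>Y_set k s t. oa_weight k s t x y * M y)"
  using \<open>x \<in> low_words k s t\<close>
proof (induction "t - card (I_set k x)" arbitrary: x rule: less_induct)
  case less
  define F where
    "F z = oa_const k s t lam z + (\<Sum>y\<in>Y_set k s t. oa_weight k s t z y * M y)" for z
  have xw: "x \<in> words k s" and xt: "card (I_set k x) \<le> t" using less.prems by (auto simp: low_words_def)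
  obtain T where T: "I_set k x \<subseteq> T" "T \<subseteq> {1..k}" "card T = t"
    using exists_subset_between[OF xt _ I_set_subset] \<open>t \<le> k\<close> by auto
  define D where "D = {z. z \<in> words k s \<and> (\<forall>i\<in>T. z i = x i)}"
  define L where "L = {z. z \<in> low_words k s t \<and> (\<forall>i\<in>T. z i = x i)}"
  define U where "U = {y \<in> Y_set k s t. \<forall>i\<in>T. y i = x i}"
  note cyl = cylinder_support[OF T(2,1) xw \<open>1 \<le> s\<close>]
  have [simp]: "finite L" "finite U" by (auto simp: L_def U_def)
  have xL: "x \<in> L" using less.prems by (simp add: L_def)
  have "D = L \<union> U" "L \<inter> U = {}" by (auto simp: D_def L_def U_def low_words_def Y_set_eq)
  then have "(\<Sum>z\<in>L. M z) + (\<Sum>z\<in>U. M z) = (\<Sum>z\<in>D. M z)"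
    by (simp add: sum.union_disjoint)
  also have "\<dots> = of_int lam"
    unfolding D_def using T xw by (intro marginals) auto
  finally have total: "(\<Sum>z\<in>L. M z) + (\<Sum>z\<in>U. M z) = of_int lam" .
  have "(\<Sum>z\<in>L. F z) = (\<Sum>z\<in>L. oa_const k s t lam z)
      + (\<Sum>y\<in>Y_set k s t. (\<Sum>z\<in>L. oa_weight k s t z y) * M y)"
    unfolding F_def sum.distrib sum_distrib_right by (subst (2) sum.swap) simp
  also have "\<dots> = of_int lam + (\<Sum>y\<in>Y_set k s t. (if \<forall>i\<in>T. y i = x i then - 1 else 0) * M y)"
    unfolding L_def
    by (simp only: sum_oa_coeff_cylinder[OF T(2,1) xw \<open>1 \<le> s\<close> T(3)]
        sum_oa_weight_cylinder[OF T(2,1) xw \<open>1 \<le> s\<close> T(3)] cong: sum.cong)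
  also have "(\<Sum>y\<in>Y_set k s t. (if \<forall>i\<in>T. y i = x i then - 1 else 0) * M y) = (\<Sum>y\<in>U. - M y)"
    by (rule sum.mono_neutral_cong_right) (auto simp: U_def)
  finally have "(\<Sum>z\<in>L. F z) = (\<Sum>z\<in>L. M z)"
    using total by (simp add: sum_negf)
  moreover have "(\<Sum>z\<in>L - {x}. F z) = (\<Sum>z\<in>L - {x}. M z)"
  proof (rule sum.cong [OF refl])
    fix z assume z: "z \<in> L - {x}"
    then have zl: "z \<in> low_words k s t" and zT: "\<forall>i\<in>T. z i = x i" and ne: "z \<noteq> x"
      by (auto simp: L_def)
    then have zw: "z \<in> words k s" and zt: "card (I_set k z) \<le> t" by (auto simp: low_words_def)
    have "I_set k z - T \<noteq> {}"
    proof
      assume "I_set k z - T = {}"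
      then have "I_set k z = I_set k x" using cyl(1)[OF zw zT] by auto
      then have "z i = x i" if "i \<in> {1..k}" for i
        using cyl(4)[OF zw zT] that by (cases "i \<in> I_set k x") (auto simp: I_set_def J_set_def)
      then show False using words_eqI[OF zw xw] ne by blast
    qed
    then have "card (I_set k x) < card (I_set k z)"
      using cyl(2)[OF zw zT] by (simp add: card_gt_0_iff)
    then have "M z = oa_const k s t lam z + (\<Sum>y\<in>Y_set k s t. oa_weight k s t z y * M y)"
      using zl zt by (intro less.hyps) auto
    then show "F z = M z" by (simp add: F_def)
  qed
  ultimately have "F x = M x"
    using xL by (simp add: sum.remove)
  then show ?case by (simp add: F_def)
qed

section \<open>Facets of the polytope\<close>

definition oa_slack :: "nat \<Rightarrow> nat \<Rightarrow> nat \<Rightarrow> int \<Rightarrow> (nat \<Rightarrow> nat) \<Rightarrow> ((nat \<Rightarrow> nat) \<Rightarrow> real) \<Rightarrow> real" where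
  "oa_slack k s t lam x N =
     oa_const k s t lam x + (\<Sum>y\<in>Y_set k s t. oa_weight k s t x y * N y)"

section \<open>Facets of a general polyhedron under permutations of the coordinates\<close>

definition polyhedron_of ::
  "'a set \<Rightarrow> 'b set \<Rightarrow> ('b \<Rightarrow> real) \<Rightarrow> ('b \<Rightarrow> 'a \<Rightarrow> real) \<Rightarrow> ('a \<Rightarrow> real) set" where
  "polyhedron_of Y X b A =
     {N \<in> extensional Y. (\<forall>y\<in>Y. 0 \<le> N y) \<and> (\<forall>x\<in>X. 0 \<le> b x + (\<Sum>y\<in>Y. A x y * N y))}"

lemma OAP_eq_polyhedron_of:
  "OAP k s t lam =
     polyhedron_of (Y_set k s t) (low_words k s t) (oa_const k s t lam) (oa_weight k s t)"
  unfolding OAP_eq polyhedron_of_def ..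

text \<open>It suffices to test vectors supported on \<open>y0\<close> and one more coordinate and
  orthogonal to \<open>a\<close>. They satisfy the premise with both signs, so \<open>b\<close> must
  be orthogonal to them too. The factor is read off at \<open>y0\<close>, and the multiple
  \<open>1 / a y0\<close> of the unit vector there shows that it is nonnegative.\<close>

lemma halfspace_subset_imp_proportional:
  fixes a b :: "'a \<Rightarrow> real"
  assumes "finite Y" "y0 \<in> Y" "a y0 \<noteq> 0"
    and imp: "\<And>v. 0 \<le> (\<Sum>y\<in>Y. a y * v y) \<Longrightarrow> 0 \<le> (\<Sum>y\<in>Y. b y * v y)"
  shows "\<exists>r\<ge>0. \<forall>y\<in>Y. b y = r * a y"
proof (intro exI conjI ballI)
  have eval: "(\<Sum>y\<in>Y. c y * (\<alpha> * of_bool (y = y1) + \<beta> * of_bool (y = y0))) = c y1 * \<alpha> + c y0 * \<beta>"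
    if "y1 \<in> Y" for y1 \<alpha> \<beta> and c :: "'a \<Rightarrow> real"
  proof -
    have "(\<Sum>y\<in>Y. c y * (\<gamma> * of_bool (y = z))) = c z * \<gamma>" if "z \<in> Y" for z \<gamma>
      by (rule trans[OF sum.mono_neutral_right[of Y "{z}"]]) (use assms(1) that in auto)
    from this[OF that] this[OF assms(2)] show ?thesis
      by (simp add: distrib_left sum.distrib)
  qed
  show "0 \<le> b y0 / a y0"
    using imp[of "\<lambda>y. (1 / a y0) * of_bool (y = y0) + 0 * of_bool (y = y0)"] assms
    unfolding eval[OF assms(2)] by simp
  fix y1 assume y1: "y1 \<in> Y"
  have "0 \<le> b y1 * \<epsilon> + b y0 * (- \<epsilon> * a y1 / a y0)" for \<epsilon>
    using imp[of "\<lambda>y. \<epsilon> * of_bool (y = y1) + (- \<epsilon> * a y1 / a y0) * of_bool (y = y0)"] assms(3)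
    unfolding eval[OF y1] by simp
  from this[of 1] this[of "- 1"] show "b y1 = b y0 / a y0 * a y1"
    by simp
qed

text \<open>A slack constraint survives a small step in any direction, a tight one survives if the
  direction does not decrease it, and positivity of \<open>p\<close> makes all sign constraints
  slack. As there are finitely many constraints, one step size serves them all.\<close>

lemma polyhedron_of_step:
  assumes "finite Y" "finite X" "\<And>y. y \<in> Y \<Longrightarrow> 0 < p y"
    and "\<And>x. x \<in> X \<Longrightarrow> 0 < b x + (\<Sum>y\<in>Y. A x y * p y) \<or>
        0 \<le> b x + (\<Sum>y\<in>Y. A x y * p y) \<and> 0 \<le> (\<Sum>y\<in>Y. A x y * v y)"
  shows "\<exists>\<delta>>0. (\<lambda>y\<in>Y. p y + \<delta> * v y) \<in> polyhedron_of Y X b A"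
proof -
  have pos: "\<forall>\<^sub>F \<delta> in at_right 0. 0 \<le> a + \<delta> * c" if "0 < a" for a c :: real
  proof -
    have "((\<lambda>\<delta>. a + \<delta> * c) \<longlongrightarrow> a + 0 * c) (at_right 0)" by (intro tendsto_intros)
    then have "\<forall>\<^sub>F \<delta> in at_right 0. 0 < a + \<delta> * c"
      using that by (intro order_tendstoD(1)) auto
    then show ?thesis by (rule eventually_mono) simp
  qed
  have slack: "b x + (\<Sum>y\<in>Y. A x y * (p y + \<delta> * v y))
      = (b x + (\<Sum>y\<in>Y. A x y * p y)) + \<delta> * (\<Sum>y\<in>Y. A x y * v y)" for x \<delta>
    by (simp add: algebra_simps sum.distrib sum_distrib_left)
  have "\<forall>\<^sub>F \<delta> in at_right 0. \<forall>y\<in>Y. 0 \<le> p y + \<delta> * v y"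
    using assms by (intro eventually_ball_finite ballI pos) auto
  moreover have "\<forall>\<^sub>F \<delta> in at_right 0.
      \<forall>x\<in>X. 0 \<le> (b x + (\<Sum>y\<in>Y. A x y * p y)) + \<delta> * (\<Sum>y\<in>Y. A x y * v y)"
  proof (intro eventually_ball_finite ballI assms)
    fix x assume "x \<in> X"
    then consider "0 < b x + (\<Sum>y\<in>Y. A x y * p y)" |
      "0 \<le> b x + (\<Sum>y\<in>Y. A x y * p y)" "0 \<le> (\<Sum>y\<in>Y. A x y * v y)"
      using assms(4) by blast
    then show "\<forall>\<^sub>F \<delta> in at_right 0. 0 \<le> (b x + (\<Sum>y\<in>Y. A x y * p y)) + \<delta> * (\<Sum>y\<in>Y. A x y * v y)"
    proof cases
      case 1
      then show ?thesis by (rule pos)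
    next
      case 2
      then show ?thesis
        by (intro eventually_mono[OF eventually_at_right_less[of 0]]) simp
    qed
  qed
  moreover have "\<forall>\<^sub>F \<delta> in at_right 0. (0 :: real) < \<delta>"
    by (rule eventually_at_right_less)
  ultimately have "\<forall>\<^sub>F \<delta> in at_right 0. 0 < \<delta> \<and>
      (\<lambda>y\<in>Y. p y + \<delta> * v y) \<in> polyhedron_of Y X b A"
    unfolding polyhedron_of_def by eventually_elim (simp add: slack)
  then show ?thesis
    using eventually_happens by fastforce
qed

lemma inv_in_coord_symmetries:
  assumes "\<sigma> \<in> coord_symmetries Y P"
  shows "inv' \<sigma> \<in> coord_symmetries Y P"
proof -
  have \<sigma>: "\<sigma> permutes Y" and im: "(\<lambda>N. N \<circ> \<sigma>) ` P = P"
    using assms by (auto simp: coord_symmetries_def)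
  have "(\<lambda>N. N \<circ> inv' \<sigma>) ` P = (\<lambda>N. N \<circ> inv' \<sigma>) ` (\<lambda>N. N \<circ> \<sigma>) ` P" by (simp only: im)
  also have "\<dots> = P"
    by (simp add: image_image comp_assoc permutes_inv_o[OF \<sigma>])
  finally show ?thesis
    using \<sigma> by (simp add: coord_symmetries_def permutes_inv)
qed

text \<open>The point \<open>p \<circ> \<sigma>\<close> has to be tight for some constraint
  \<open>x\<close>, and the half-space of feasible directions at \<open>p\<close> is transported
  into the half-space of \<open>x\<close>, which forces proportionality. The value
  \<open>r = 0\<close> is still possible here and must be excluded by a nonzero coefficient of
  \<open>x\<close>.\<close>

lemma facet_image:
  fixes A :: "'b \<Rightarrow> 'a \<Rightarrow> real"
  assumes fin: "finite Y" "finite X"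
    and \<sigma>: "\<sigma> \<in> coord_symmetries Y (polyhedron_of Y X b A)"
    and p: "p \<in> polyhedron_of Y X b A" "\<forall>y\<in>Y. 0 < p y"
      "b x0 + (\<Sum>y\<in>Y. A x0 y * p y) = 0"
      "\<forall>x\<in>X. x \<noteq> x0 \<longrightarrow> 0 < b x + (\<Sum>y\<in>Y. A x y * p y)"
    and x0: "x0 \<in> X" "y0 \<in> Y" "A x0 y0 \<noteq> 0"
  obtains x r where "x \<in> X" "0 \<le> r" "\<forall>y\<in>Y. A x y = r * A x0 (\<sigma> y)"
proof -
  let ?P = "polyhedron_of Y X b A"
  have perm: "\<sigma> permutes Y" and im: "(\<lambda>N. N \<circ> \<sigma>) ` ?P = ?P"
    using \<sigma> by (auto simp: coord_symmetries_def)
  have in_Y [simp]: "\<sigma> y \<in> Y \<longleftrightarrow> y \<in> Y" for y by (rule permutes_in_image[OF perm])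
  have img: "N \<circ> \<sigma> \<in> ?P" if "N \<in> ?P" for N using im that by blast
  define q where "q = p \<circ> \<sigma>"
  have qP: "q \<in> ?P" unfolding q_def by (rule img[OF p(1)])
  have qpos: "0 < q y" if "y \<in> Y" for y using p(2) that by (simp add: q_def)
  have "\<exists>x\<in>X. b x + (\<Sum>y\<in>Y. A x y * q y) = 0"
  proof (rule ccontr)
    assume "\<not> (\<exists>x\<in>X. b x + (\<Sum>y\<in>Y. A x y * q y) = 0)"
    then have interior: "0 < b x + (\<Sum>y\<in>Y. A x y * q y)" if "x \<in> X" for x
      using qP that by (force simp: polyhedron_of_def order.strict_iff_order)
    \<comment> \<open>This direction lowers the tight constraint \<open>x0\<close> at the rate
      \<open>A x0 y0\<close> squared. If \<open>q\<close> were interior, a step along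
      \<open>v \<circ> \<sigma>\<close> would stay in the polyhedron, and undoing \<sigma> would
      give a point of the polyhedron that violates \<open>x0\<close>.\<close>
    define v where "v = (\<lambda>y. if y = y0 then - A x0 y0 else 0)"
    have "\<exists>\<delta>>0. (\<lambda>y\<in>Y. q y + \<delta> * (v \<circ> \<sigma>) y) \<in> ?P"
      by (rule polyhedron_of_step[OF fin qpos]) (use interior in blast)+
    then obtain \<delta> where \<delta>: "0 < \<delta>" "(\<lambda>y\<in>Y. q y + \<delta> * (v \<circ> \<sigma>) y) \<in> ?P" by blast
    then obtain N where N: "N \<in> ?P" "(\<lambda>y\<in>Y. q y + \<delta> * (v \<circ> \<sigma>) y) = N \<circ> \<sigma>"
      using im by (metis (no_types, lifting) imageE)
    have "N y = p y + \<delta> * v y" if "y \<in> Y" for y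
    proof -
      have "inv' \<sigma> y \<in> Y" using permutes_in_image[OF permutes_inv[OF perm]] that by blast
      then show ?thesis
        using fun_cong[OF N(2), of "inv' \<sigma> y"] permutes_inverses(1)[OF perm] by (simp add: q_def)
    qed
    then have "b x0 + (\<Sum>y\<in>Y. A x0 y * N y)
        = (b x0 + (\<Sum>y\<in>Y. A x0 y * p y)) + \<delta> * (\<Sum>y\<in>Y. A x0 y * v y)"
      by (simp add: algebra_simps sum.distrib sum_distrib_left)
    also have "(\<Sum>y\<in>Y. A x0 y * v y) = - (A x0 y0 * A x0 y0)"
      using fin x0 by (simp add: v_def if_distrib cong: if_cong)
    also have "b x0 + (\<Sum>y\<in>Y. A x0 y * p y) = 0" by (rule p)
    finally have "b x0 + (\<Sum>y\<in>Y. A x0 y * N y) < 0"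
      using \<delta>(1) x0(3) by (simp add: zero_less_mult_iff not_square_less_zero) (metis linorder_neqE_linordered_idom)
    then show False
      using N(1) x0(1) by (auto simp: polyhedron_of_def)
  qed
  then obtain x where x: "x \<in> X" "b x + (\<Sum>y\<in>Y. A x y * q y) = 0" by blast
  have shift: "(\<Sum>y\<in>Y. A x y * w (\<sigma> y)) = (\<Sum>y\<in>Y. A x (inv' \<sigma> y) * w y)" for w
    by (subst sum.permute[OF perm, of "\<lambda>y. A x (inv' \<sigma> y) * w y"]) (simp add: o_def permutes_inverses[OF perm])
  \<comment> \<open>Since \<open>x0\<close> is the only tight constraint at \<open>p\<close>, every
    direction not decreasing it is feasible at \<open>p\<close>. Composition with \<sigma> makes it
    feasible at \<open>q\<close>, where \<open>x\<close> is tight and hence cannot decrease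
    either.\<close>
  have "\<exists>r\<ge>0. \<forall>y\<in>Y. A x (inv' \<sigma> y) = r * A x0 y"
  proof (rule halfspace_subset_imp_proportional[where a = "A x0", OF fin(1) x0(2,3)])
    fix v assume v: "0 \<le> (\<Sum>y\<in>Y. A x0 y * v y)"
    have "\<exists>\<delta>>0. (\<lambda>y\<in>Y. p y + \<delta> * v y) \<in> ?P"
    proof (rule polyhedron_of_step[OF fin p(2)[rule_format]])
      fix x' assume "x' \<in> X"
      then show "0 < b x' + (\<Sum>y\<in>Y. A x' y * p y) \<or>
          0 \<le> b x' + (\<Sum>y\<in>Y. A x' y * p y) \<and> 0 \<le> (\<Sum>y\<in>Y. A x' y * v y)"
        using p(3,4) v by (cases "x' = x0") auto
    qed
    then obtain \<delta> where \<delta>: "0 < \<delta>" "(\<lambda>y\<in>Y. p y + \<delta> * v y) \<in> ?P" by blast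
    have "(\<lambda>y\<in>Y. p y + \<delta> * v y) \<circ> \<sigma> \<in> ?P" by (rule img[OF \<delta>(2)])
    then have "0 \<le> b x + (\<Sum>y\<in>Y. A x y * (q y + \<delta> * v (\<sigma> y)))"
      using x(1) by (simp add: polyhedron_of_def q_def cong: sum.cong)
    also have "\<dots> = (b x + (\<Sum>y\<in>Y. A x y * q y)) + \<delta> * (\<Sum>y\<in>Y. A x y * v (\<sigma> y))"
      by (simp add: algebra_simps sum.distrib sum_distrib_left)
    finally have "0 \<le> (\<Sum>y\<in>Y. A x y * v (\<sigma> y))"
      using x(2) \<delta>(1) by (simp add: zero_le_mult_iff)
    then show "0 \<le> (\<Sum>y\<in>Y. A x (inv' \<sigma> y) * v y)" by (simp add: shift)
  qed
  then obtain r where r: "0 \<le> r" "\<forall>y\<in>Y. A x (inv' \<sigma> y) = r * A x0 y" by blast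
  have "A x y = r * A x0 (\<sigma> y)" if "y \<in> Y" for y
    using r(2)[rule_format, of "\<sigma> y"] that by (simp add: permutes_inverses[OF perm])
  then show thesis using that x(1) r(1) by blast
qed

section \<open>A function with vanishing \<open>t\<close>-dimensional marginals and a strict maximum
  at \<open>x\<close>\<close>

context
  fixes k s t :: nat and x :: "nat \<Rightarrow> nat"
  assumes s: "2 \<le> s" and tk: "t < k" and x: "x \<in> words k s" and big: "t + 1 < k \<or> 2 < s"
begin

definition agree :: "(nat \<Rightarrow> nat) \<Rightarrow> nat \<Rightarrow> real" where
  "agree z i = (if z i = x i then real s - 1 else - 1)"

text \<open>
  By expanding the product over the coordinates, every \<open>t\<close>-dimensional marginal of a term
  vanishes: some coordinate of \<open>S\<close> is summed over, and \<open>agree\<close> has mean zero there.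
  Two sizes of \<open>S\<close> are needed to make \<open>x\<close> the unique maximiser when \<open>s = 2\<close>.
\<close>

definition peak :: "(nat \<Rightarrow> nat) \<Rightarrow> real" where
  "peak z = (\<Sum>S | S \<subseteq> {1..k} \<and> t < card S. \<Prod>i\<in>S. agree z i)"

text \<open>Both the cylinder and the summand are products over the coordinates, so the sum
  factorises. The case of empty \<open>S\<close> counts the cylinder.\<close>

lemma sum_cylinder_prod_agree:
  assumes "T \<subseteq> {1..k}" "w \<in> words k s" "S \<subseteq> {1..k}"
  shows "(\<Sum>z | z \<in> words k s \<and> (\<forall>i\<in>T. z i = w i). \<Prod>i\<in>S. agree z i)
       = (\<Prod>i\<in>{1..k}. \<Sum>a\<in>(if i \<in> T then {w i} else {1..s}).
            if i \<in> S then (if a = x i then real s - 1 else - 1) else 1)"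
proof -
  let ?B = "\<lambda>i. if i \<in> T then {w i} else {1..s}"
  have "{z. z \<in> words k s \<and> (\<forall>i\<in>T. z i = w i)} = PiE {1..k} ?B"
  proof (intro equalityI subsetI)
    fix z assume z: "z \<in> {z. z \<in> words k s \<and> (\<forall>i\<in>T. z i = w i)}"
    show "z \<in> PiE {1..k} ?B"
      by (rule PiE_I) (use z words_in words_out in auto)
  next
    fix z assume z: "z \<in> PiE {1..k} ?B"
    have zi: "z i \<in> ?B i" if "i \<in> {1..k}" for i using z that by (rule PiE_mem)
    have "z \<in> words k s"
    proof (rule wordsI)
      fix i assume i: "i \<in> {1..k}"
      show "z i \<in> {1..s}" using zi[OF i] words_in[OF assms(2) i] by (simp split: if_splits)
    qed (rule PiE_arb[OF z])
    moreover have "z i = w i" if "i \<in> T" for i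
      using zi[of i] that assms(1) by (simp add: subset_iff)
    ultimately show "z \<in> {z. z \<in> words k s \<and> (\<forall>i\<in>T. z i = w i)}" by blast
  qed
  moreover have "(\<Prod>i\<in>S. agree z i)
      = (\<Prod>i\<in>{1..k}. if i \<in> S then (if z i = x i then real s - 1 else - 1) else 1)" for z
    using assms(3) by (intro prod.mono_neutral_cong_left) (auto simp: agree_def)
  ultimately show ?thesis
    by (simp add: prod_sum_PiE)
qed

lemma sum_cylinder_prod_agree_0:
  assumes "T \<subseteq> {1..k}" "w \<in> words k s" "S \<subseteq> {1..k}" "card T < card S"
  shows "(\<Sum>z | z \<in> words k s \<and> (\<forall>i\<in>T. z i = w i). \<Prod>i\<in>S. agree z i) = 0"
proof -
  have "\<not> S \<subseteq> T"
    using assms card_mono[of T S] finite_subset[OF assms(1)] by auto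
  then obtain l where l: "l \<in> S" "l \<notin> T" "l \<in> {1..k}" using assms by blast
  have "(\<Sum>a\<in>{1..s}. if a = x l then real s - 1 else - 1)
      = (real s - 1) + (\<Sum>a\<in>{1..s} - {x l}. - 1)"
    using words_in[OF x l(3)] by (subst sum.remove[of _ "x l"]) (auto intro!: sum.cong)
  also have "\<dots> = 0" using words_in[OF x l(3)] s by (simp add: of_nat_diff)
  finally show ?thesis
    unfolding sum_cylinder_prod_agree[OF assms(1-3)] using l by (intro prod_zero) auto
qed

lemma card_cylinder:
  assumes "T \<subseteq> {1..k}" "w \<in> words k s"
  shows "card {z. z \<in> words k s \<and> (\<forall>i\<in>T. z i = w i)} = s ^ (k - card T)"
proof -
  have "real (card {z. z \<in> words k s \<and> (\<forall>i\<in>T. z i = w i)})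
      = (\<Prod>i\<in>{1..k}. \<Sum>a\<in>(if i \<in> T then {w i} else {1..s}). 1)"
    using sum_cylinder_prod_agree[OF assms, of "{}"] by simp
  also have "\<dots> = (\<Prod>i\<in>{1..k}. if i \<in> {1..k} - T then real s else 1)"
    by (rule prod.cong) auto
  also have "\<dots> = (\<Prod>i\<in>{1..k} - T. real s)"
    by (rule prod.mono_neutral_cong_right) auto
  also have "\<dots> = real (s ^ (k - card T))"
    using assms(1) by (simp add: card_Diff_subset finite_subset)
  finally show ?thesis by (simp only: of_nat_eq_iff)
qed

lemma sum_cylinder_peak:
  assumes "T \<subseteq> {1..k}" "w \<in> words k s" "card T = t"
  shows "(\<Sum>z | z \<in> words k s \<and> (\<forall>i\<in>T. z i = w i). peak z) = 0"
  unfolding peak_def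
  by (subst sum.swap, rule sum.neutral) (use sum_cylinder_prod_agree_0[OF assms(1,2)] assms(3) in auto)

lemma prod_agree_le: "(\<Prod>i\<in>S. agree z i) \<le> (real s - 1) ^ card S"
proof -
  have "(\<Prod>i\<in>S. agree z i) \<le> (\<Prod>i\<in>S. \<bar>agree z i\<bar>)"
    using abs_ge_self[of "\<Prod>i\<in>S. agree z i"] by (simp add: abs_prod)
  also have "\<dots> \<le> (\<Prod>i\<in>S. real s - 1)"
    using s by (intro prod_mono) (auto simp: agree_def)
  finally show ?thesis by simp
qed

lemma peak_self: "peak x = (\<Sum>S | S \<subseteq> {1..k} \<and> t < card S. (real s - 1) ^ card S)"
  by (simp add: peak_def agree_def)

lemma peak_pos: "0 < peak x"
  unfolding peak_self
  by (rule sum_pos2[of _ "{1..k}"]) (use s tk in auto)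

text \<open>No summand exceeds its value at \<open>x\<close>, so one strict inequality is enough.
  Let \<open>z\<close> and \<open>x\<close> differ at \<open>l\<close>. If \<open>s > 2\<close>, the
  full set works, because the factor at \<open>l\<close> has absolute value 1 instead of
  \<open>s - 1\<close>. If \<open>s = 2\<close>, all products are 1 or -1, and those over
  \<open>{1..k}\<close> and \<open>{1..k} - {l}\<close> are negatives of each other, so one of them
  is -1; the smaller set is admissible because \<open>t + 1 < k\<close>.\<close>

lemma peak_less:
  assumes "z \<in> words k s" "z \<noteq> x"
  shows "peak z < peak x"
  unfolding peak_self peak_def[of z]
proof (rule sum_strict_mono_ex1)
  show "finite {S. S \<subseteq> {1..k} \<and> t < card S}" by simp
  show "\<forall>S\<in>{S. S \<subseteq> {1..k} \<and> t < card S}. (\<Prod>i\<in>S. agree z i) \<le> (real s - 1) ^ card S"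
    using prod_agree_le by blast
  obtain l where l: "l \<in> {1..k}" "z l \<noteq> x l" using words_eqI[OF assms(1) x] assms(2) by blast
  let ?R = "\<Prod>i\<in>{1..k} - {l}. agree z i"
  have split: "(\<Prod>i\<in>{1..k}. agree z i) = - ?R"
    using l by (simp add: prod.remove[of _ l] agree_def)
  show "\<exists>S\<in>{S. S \<subseteq> {1..k} \<and> t < card S}. (\<Prod>i\<in>S. agree z i) < (real s - 1) ^ card S"
  proof (cases "2 < s")
    case True
    have "\<bar>?R\<bar> = (\<Prod>i\<in>{1..k} - {l}. \<bar>agree z i\<bar>)" by (rule abs_prod)
    also have "\<dots> \<le> (\<Prod>i\<in>{1..k} - {l}. real s - 1)"
      using s by (intro prod_mono) (auto simp: agree_def)
    also have "\<dots> < (real s - 1) ^ k"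
      using l True tk by (simp add: power_strict_increasing)
    finally show ?thesis
      using split tk by (intro bexI[of _ "{1..k}"]) auto
  next
    case False
    then have "s = 2" "t + 1 < k" using s big by auto
    then have "(\<Prod>i\<in>{1..k}. agree z i) < (real s - 1) ^ card {1..k}
        \<or> ?R < (real s - 1) ^ card ({1..k} - {l})"
      using split by (simp, linarith)
    then show ?thesis
      using l tk \<open>t + 1 < k\<close>
      by (elim disjE, intro bexI[of _ "{1..k}"], simp, simp, intro bexI[of _ "{1..k} - {l}"]) auto
  qed
qed

end

text \<open>The array \<open>M\<close> below is zero at \<open>x\<close>, positive at all other
  words, and has all \<open>t\<close>-dimensional marginals equal to \<open>lam\<close>. By
  \<open>oa_frequency_eq\<close> its values on the low words are the slacks of its restriction to
  \<open>Y_set\<close>.\<close>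

lemma exists_point_one_tight:
  assumes "2 \<le> s" "t < k" "t + 1 < k \<or> 2 < s" "1 \<le> lam" "x \<in> low_words k s t"
  obtains p where "p \<in> OAP k s t lam" "\<forall>y\<in>Y_set k s t. 0 < p y" "oa_slack k s t lam x p = 0"
    "\<forall>x'\<in>low_words k s t. x' \<noteq> x \<longrightarrow> 0 < oa_slack k s t lam x' p"
proof -
  have xw: "x \<in> words k s" using assms by (simp add: low_words_def)
  note ctx = assms(1,2) xw assms(3)
  \<comment> \<open>The frequency of the uniform array: each cylinder over \<open>t\<close>
    coordinates has \<open>s ^ (k - t)\<close> words and must have total mass
    \<open>lam\<close>.\<close>
  define c where "c = of_int lam / real s ^ (k - t)"
  have c: "0 < c" using assms by (simp add: c_def)
  \<comment> \<open>Normalised by its maximum, \<open>peak\<close> removes the whole uniform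
    frequency at \<open>x\<close> and less than that at every other word, without changing the
    marginals.\<close>
  define M where "M = (\<lambda>z. c * (1 - peak k s t x z / peak k s t x x))"
  define p where "p = restrict M (Y_set k s t)"
  have pos: "0 < M z" if "z \<in> words k s" "z \<noteq> x" for z
    using peak_less[OF ctx that] peak_pos[OF ctx] c by (simp add: M_def)
  have zero: "M x = 0" using peak_pos[OF ctx] by (simp add: M_def)
  have "(\<Sum>z | z \<in> words k s \<and> (\<forall>i\<in>T. z i = w i). M z) = of_int lam"
    if "T \<subseteq> {1..k}" "card T = t" "w \<in> words k s" for T w
  proof -
    let ?Z = "{z. z \<in> words k s \<and> (\<forall>i\<in>T. z i = w i)}"
    have "(\<Sum>z\<in>?Z. M z) = c * (real (card ?Z) - (\<Sum>z\<in>?Z. peak k s t x z) / peak k s t x x)"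
      by (simp add: M_def sum_distrib_left[symmetric] sum_subtractf sum_divide_distrib)
    also have "\<dots> = of_int lam"
      using card_cylinder[OF ctx that(1,3)] sum_cylinder_peak[OF ctx that(1,3,2)] that(2) assms(1)
      by (simp add: c_def)
    finally show ?thesis .
  qed
  then have "M x' = oa_const k s t lam x' + (\<Sum>y\<in>Y_set k s t. oa_weight k s t x' y * M y)"
    if "x' \<in> low_words k s t" for x'
    using that assms by (intro oa_frequency_eq) auto
  then have slack: "oa_slack k s t lam x' p = M x'" if "x' \<in> low_words k s t" for x'
    using that by (simp add: oa_slack_def p_def cong: sum.cong)
  have ppos: "0 < p y" if "y \<in> Y_set k s t" for y
  proof -
    have "y \<noteq> x" "y \<in> words k s" using that assms(5) by (auto simp: Y_set_eq low_words_def)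
    then show ?thesis using pos that by (simp add: p_def)
  qed
  have low: "x' \<in> words k s" if "x' \<in> low_words k s t" for x' using that by (simp add: low_words_def)
  have "p \<in> OAP k s t lam"
  proof -
    have "0 \<le> oa_slack k s t lam x' p" if "x' \<in> low_words k s t" for x'
      using slack[OF that] pos[OF low[OF that]] zero by (cases "x' = x") auto
    moreover have "p \<in> extensional (Y_set k s t)" by (simp add: p_def)
    ultimately show ?thesis
      unfolding OAP_eq using ppos by (auto simp: oa_slack_def intro: less_imp_le)
  qed
  then show thesis
    using that ppos slack pos zero low assms(5) by metis
qed

section \<open>Block symmetries\<close>

text \<open>For a low word \<open>x\<close> this is the support of its coefficient vector, see
  \<open>oa_weight_nonzero_iff\<close>.\<close>

definition block :: "nat \<Rightarrow> nat \<Rightarrow> nat \<Rightarrow> (nat \<Rightarrow> nat) \<Rightarrow> (nat \<Rightarrow> nat) set" where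
  "block k s t x = J_set k s x \<inter> Y_set k s t"

definition base_words :: "nat \<Rightarrow> nat \<Rightarrow> nat \<Rightarrow> (nat \<Rightarrow> nat) set" where
  "base_words k s t = {x \<in> words k s. card (I_set k x) = t}"

text \<open>All that the reconstruction retains of a symmetry of the polytope. Constants, signs and
  sizes of coefficients have disappeared, and so has \<open>lam\<close>.\<close>

definition block_symmetry :: "nat \<Rightarrow> nat \<Rightarrow> nat \<Rightarrow> ((nat \<Rightarrow> nat) \<Rightarrow> nat \<Rightarrow> nat) \<Rightarrow> bool" where
  "block_symmetry k s t \<sigma> \<longleftrightarrow> \<sigma> permutes Y_set k s t \<and>
     (`) \<sigma> ` block k s t ` base_words k s t = block k s t ` base_words k s t"

text \<open>A set of words large enough to tell the blocks apart, yet with a simple symmetry group.\<close>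

definition test_words :: "nat \<Rightarrow> nat \<Rightarrow> (nat \<Rightarrow> nat) set" where
  "test_words k s = {y \<in> words k s. card (I_set k y) = (if 2 < s then k else k - 1)}"

lemma card_I_set_eq_k: "card (I_set k y) = k \<longleftrightarrow> (\<forall>i\<in>{1..k}. y i \<noteq> 1)"
proof
  assume "card (I_set k y) = k"
  then have "I_set k y = {1..k}" using card_subset_eq[OF _ I_set_subset, of k y] by simp
  then show "\<forall>i\<in>{1..k}. y i \<noteq> 1" by (auto simp: I_set_def)
next
  assume "\<forall>i\<in>{1..k}. y i \<noteq> 1"
  then have "I_set k y = {1..k}" by (auto simp: I_set_def)
  then show "card (I_set k y) = k" by simp
qed

lemma exists_extension:
  assumes "2 \<le> s" "x \<in> words k s" "card (I_set k x) \<le> m" "m \<le> k"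
  obtains y where "y \<in> J_set k s x" "card (I_set k y) = m"
proof -
  obtain E where E: "I_set k x \<subseteq> E" "E \<subseteq> {1..k}" "card E = m"
    using exists_subset_between[OF assms(3) _ I_set_subset] assms(4) by auto
  define y where "y = (\<lambda>i\<in>{1..k}. if x i \<noteq> 1 then x i else if i \<in> E then 2 else 1)"
  have "y \<in> words k s"
    using words_in[OF assms(2)] assms(1) by (intro wordsI) (auto simp: y_def)
  then have "y \<in> J_set k s x" by (auto simp: J_set_def I_set_def y_def)
  moreover have "I_set k y = E" using E by (auto simp: I_set_def y_def)
  ultimately show thesis using that E(3) by blast
qed

text \<open>The witness is \<open>u\<close> cut down to \<open>E\<close>, with 1 elsewhere. As
  \<open>u\<close> avoids level 1 on \<open>E\<close>, nothing of \<open>E\<close> is lost from the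
  support.\<close>

lemma exists_base_word:
  assumes "1 \<le> s" "u \<in> words k s" "E \<subseteq> I_set k u" "card E = t"
  obtains x where "x \<in> base_words k s t" "I_set k x = E" "\<forall>v. v \<in> J_set k s x \<longleftrightarrow> v \<in> words k s \<and> (\<forall>i\<in>E. v i = u i)"
proof -
  define x where "x = (\<lambda>i\<in>{1..k}. if i \<in> E then u i else 1)"
  have x: "x \<in> words k s"
    using words_in[OF assms(2)] assms(1) by (intro wordsI) (auto simp: x_def)
  have I: "I_set k x = E" using assms(3) by (auto simp: I_set_def x_def)
  have xu: "x i = u i" if "i \<in> E" for i
  proof -
    have "i \<in> I_set k u" using that assms(3) by blast
    then show ?thesis using that by (simp add: x_def I_set_def)
  qed
  show thesis
  proof (rule that)
    show "x \<in> base_words k s t" using x I assms(4) by (simp add: base_words_def)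
    show "\<forall>v. v \<in> J_set k s x \<longleftrightarrow> v \<in> words k s \<and> (\<forall>i\<in>E. v i = u i)"
      using xu unfolding J_set_def I by auto
  qed (rule I)
qed

text \<open>A word with \<open>y\<close> in its \<open>J_set\<close> copies \<open>y\<close> on its
  support, so the support determines it. To serve \<open>y'\<close> as well, the support must
  consist of positions where both words have the same level other than 1.\<close>

lemma card_base_words_below_both:
  assumes "1 \<le> s" "y \<in> words k s" "y' \<in> words k s"
  shows "card {x \<in> base_words k s t. y \<in> J_set k s x \<and> y' \<in> J_set k s x}
       = card {i \<in> {1..k}. y i = y' i \<and> y i \<noteq> 1} choose t"
proof -
  let ?C = "{i \<in> {1..k}. y i = y' i \<and> y i \<noteq> 1}"
  have "bij_betw (I_set k) {x \<in> base_words k s t. y \<in> J_set k s x \<and> y' \<in> J_set k s x}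
      {E. E \<subseteq> ?C \<and> card E = t}"
  proof (rule bij_betw_imageI)
    show "inj_on (I_set k) {x \<in> base_words k s t. y \<in> J_set k s x \<and> y' \<in> J_set k s x}"
    proof (rule inj_onI)
      fix x x'
      assume x: "x \<in> {x \<in> base_words k s t. y \<in> J_set k s x \<and> y' \<in> J_set k s x}"
        and x': "x' \<in> {x \<in> base_words k s t. y \<in> J_set k s x \<and> y' \<in> J_set k s x}"
        and eq: "I_set k x = I_set k x'"
      show "x = x'"
      proof (rule words_eqI)
        fix i assume i: "i \<in> {1..k}"
        show "x i = x' i"
        proof (cases "i \<in> I_set k x")
          case True
          then show ?thesis using x x' eq by (simp add: J_set_def)
        next
          case False
          then have "x i = 1" "x' i = 1" using eq i by (auto simp: I_set_def)
          then show ?thesis by simp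
        qed
      qed (use x x' in \<open>auto simp: base_words_def\<close>)
    qed
    show "I_set k ` {x \<in> base_words k s t. y \<in> J_set k s x \<and> y' \<in> J_set k s x} = {E. E \<subseteq> ?C \<and> card E = t}"
    proof (intro equalityI subsetI)
      fix E assume "E \<in> I_set k ` {x \<in> base_words k s t. y \<in> J_set k s x \<and> y' \<in> J_set k s x}"
      then show "E \<in> {E. E \<subseteq> ?C \<and> card E = t}"
        by (auto simp: base_words_def J_set_def I_set_def)
    next
      fix E assume E: "E \<in> {E. E \<subseteq> ?C \<and> card E = t}"
      then have "E \<subseteq> I_set k y" "card E = t" by (auto simp: I_set_def)
      then obtain x where x: "x \<in> base_words k s t" "I_set k x = E"
        "\<forall>v. v \<in> J_set k s x \<longleftrightarrow> v \<in> words k s \<and> (\<forall>i\<in>E. v i = y i)"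
        by (rule exists_base_word[OF assms(1,2)])
      have "y' i = y i" if "i \<in> E" for i using E that by auto
      then show "E \<in> I_set k ` {x \<in> base_words k s t. y \<in> J_set k s x \<and> y' \<in> J_set k s x}"
        using x assms by (intro image_eqI[of _ _ x]) auto
    qed
  qed
  then show ?thesis
    by (simp add: bij_betw_same_card n_subsets)
qed

text \<open>As a function of the upper entry the binomial is zero below \<open>t\<close> and
  strictly increasing afterwards. The bound \<open>t \<le> n\<close> makes the common value nonzero;
  two zeros would give no information.\<close>

lemma binomial_left_inject:
  assumes "0 < t" "t \<le> n" "m choose t = n choose t"
  shows "m = n"
proof -
  have less: "a choose t < b choose t" if "a < b" "t \<le> b" for a b
  proof (cases "t \<le> a + 1")
    case True
    have "a choose t < Suc a choose t"
      using True assms(1) by (cases t) (auto simp: zero_less_binomial)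
    also have "\<dots> \<le> b choose t" using that by (intro binomial_right_mono) auto
    finally show ?thesis .
  qed (use that in \<open>simp add: binomial_eq_0 zero_less_binomial\<close>)
  have "t \<le> m" using assms by (metis binomial_eq_0 not_le zero_less_binomial less_irrefl)
  then show ?thesis using less[of m n] less[of n m] assms by (metis less_irrefl linorder_neqE_nat)
qed

context
  fixes k s t :: nat
  assumes s: "2 \<le> s" and t: "0 < t" "t < k" and big: "t + 1 < k \<or> 2 < s"
begin

lemma test_words_subset: "test_words k s \<subseteq> Y_set k s t"
  using big t by (auto simp: test_words_def Y_set_eq split: if_splits)

lemma exists_separating_test_word:
  assumes "x \<in> base_words k s t" "x' \<in> base_words k s t" "i \<in> {1..k}" "x i \<noteq> 1" "x' i \<noteq> x i"
  obtains y where "y \<in> test_words k s" "y \<in> J_set k s x'" "y \<notin> J_set k s x"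
proof -
  have x: "x \<in> words k s" and x': "x' \<in> words k s" using assms by (auto simp: base_words_def)
  have "\<exists>y \<in> test_words k s. y \<in> J_set k s x' \<and> y i \<noteq> x i"
  proof (cases "2 < s")
    case True
    \<comment> \<open>Free positions receive a level from 2 and 3 that differs from
      \<open>x i\<close>, so \<open>y i \<noteq> x i\<close> holds also when
      \<open>x' i = 1\<close>. A third level is essential for this choice.\<close>
    define y where "y = (\<lambda>j\<in>{1..k}. if x' j \<noteq> 1 then x' j else if x i = 2 then 3 else 2)"
    have "y \<in> words k s" using words_in[OF x'] True by (intro wordsI) (auto simp: y_def)
    moreover have "card (I_set k y) = k" by (simp add: card_I_set_eq_k y_def)
    moreover have "y \<in> J_set k s x'" using \<open>y \<in> words k s\<close> by (auto simp: J_set_def I_set_def y_def)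
    ultimately show ?thesis using assms(3-5) True by (intro bexI[of _ y]) (auto simp: test_words_def y_def)
  next
    case False
    then have [simp]: "s = 2" using s by simp
    have le2: "x j \<in> {1, 2}" "x' j \<in> {1, 2}" if "j \<in> {1..k}" for j
      using words_in[OF x that] words_in[OF x' that] by auto
    have xi: "x i = 2" "x' i = 1" using le2[OF assms(3)] assms(4,5) by auto
    \<comment> \<open>With two levels the separating word must have level 1 at \<open>i\<close>, so
      it cannot have weight \<open>k\<close>. This is why \<open>test_words\<close> has weight
      \<open>k - 1\<close> for \<open>s = 2\<close>.\<close>
    define y where "y = (\<lambda>j\<in>{1..k}. if j = i then 1 else (2 :: nat))"
    have y: "y \<in> words k s" by (intro wordsI) (auto simp: y_def)
    have "I_set k y = {1..k} - {i}" by (auto simp: I_set_def y_def)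
    then have "card (I_set k y) = k - 1" using assms(3) by simp
    moreover have "y j = x' j" if "j \<in> I_set k x'" for j
      using that le2(2)[of j] xi by (auto simp: I_set_def y_def)
    ultimately show ?thesis using y xi assms(3) by (intro bexI[of _ y]) (auto simp: test_words_def J_set_def y_def)
  qed
  then obtain y where y: "y \<in> test_words k s" "y \<in> J_set k s x'" "y i \<noteq> x i" by blast
  have "y \<notin> J_set k s x" using y(3) assms(3,4) by (auto simp: J_set_def I_set_def)
  then show thesis using that y by blast
qed

lemma base_words_eqI:
  assumes "x \<in> base_words k s t" "x' \<in> base_words k s t"
    and "\<And>y. y \<in> test_words k s \<Longrightarrow> y \<in> J_set k s x \<longleftrightarrow> y \<in> J_set k s x'"
  shows "x = x'"
proof (rule ccontr)
  assume "x \<noteq> x'"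
  then obtain i where i: "i \<in> {1..k}" "x i \<noteq> x' i"
    using words_eqI[of x k s x'] assms by (auto simp: base_words_def)
  then consider "x i \<noteq> 1" | "x' i \<noteq> 1" by force
  then show False
    using exists_separating_test_word[OF assms(1,2) i(1)] exists_separating_test_word[OF assms(2,1) i(1)]
      i(2) assms(3) by metis
qed

lemma inj_on_block: "inj_on (block k s t) (base_words k s t)"
proof (rule inj_onI)
  fix x x' assume "x \<in> base_words k s t" "x' \<in> base_words k s t" "block k s t x = block k s t x'"
  then show "x = x'" using test_words_subset by (intro base_words_eqI) (auto simp: block_def)
qed

lemma oa_weight_base_word:
  assumes "x \<in> base_words k s t"
  shows "oa_weight k s t x y = (if y \<in> J_set k s x then - 1 else 0)"
  using assms by (simp add: base_words_def oa_weight_def)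

lemma oa_weight_nonzero_iff:
  assumes "x \<in> low_words k s t" "y \<in> Y_set k s t"
  shows "oa_weight k s t x y \<noteq> 0 \<longleftrightarrow> y \<in> J_set k s x"
  using assms by (auto simp: oa_weight_def low_words_def Y_set_eq)

lemma block_nonempty:
  assumes "x \<in> low_words k s t"
  shows "block k s t x \<noteq> {}"
proof -
  have "x \<in> words k s" "card (I_set k x) \<le> k" using assms card_I_set_le by (auto simp: low_words_def)
  then obtain y where "y \<in> J_set k s x" "card (I_set k y) = k"
    by (rule exists_extension[OF s _ _ order.refl])
  then show ?thesis using t by (auto simp: block_def J_set_def Y_set_eq)
qed

lemma card_block_full:
  assumes "x \<in> low_words k s t" "k = t + 1"
  shows "card (block k s t x) = (s - 1) ^ (k - card (I_set k x))"
proof -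
  let ?B = "\<lambda>i. if i \<in> I_set k x then {x i} else {2..s}"
  have x: "x \<in> words k s" using assms by (simp add: low_words_def)
  have "block k s t x = {y \<in> words k s. (\<forall>i\<in>I_set k x. y i = x i) \<and> (\<forall>i\<in>{1..k}. y i \<noteq> 1)}"
  proof -
    have "t < card (I_set k y) \<longleftrightarrow> (\<forall>i\<in>{1..k}. y i \<noteq> 1)" for y
      using card_I_set_eq_k[of k y] card_I_set_le[of k y] assms(2) by linarith
    then show ?thesis by (auto simp: block_def J_set_def Y_set_eq)
  qed
  also have "\<dots> = PiE {1..k} ?B"
  proof (intro equalityI subsetI)
    fix y assume y: "y \<in> {y \<in> words k s. (\<forall>i\<in>I_set k x. y i = x i) \<and> (\<forall>i\<in>{1..k}. y i \<noteq> 1)}"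
    show "y \<in> PiE {1..k} ?B"
    proof (rule PiE_I)
      fix i assume i: "i \<in> {1..k}"
      then have "y i \<in> {1..s}" "y i \<noteq> 1" using y words_in by blast+
      then show "y i \<in> ?B i" using y by auto
    qed (use y words_out in blast)
  next
    fix y assume y: "y \<in> PiE {1..k} ?B"
    have yi: "y i \<in> ?B i" if "i \<in> {1..k}" for i using y that by (rule PiE_mem)
    have "y \<in> words k s"
    proof (rule wordsI)
      fix i assume i: "i \<in> {1..k}"
      show "y i \<in> {1..s}" using yi[OF i] words_in[OF x i] by (auto split: if_splits)
    qed (rule PiE_arb[OF y])
    moreover have "y i = x i" if "i \<in> I_set k x" for i
    proof -
      have "i \<in> {1..k}" using that by (simp add: I_set_def)
      from yi[OF this] show ?thesis using that by simp
    qed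
    moreover have "y i \<noteq> 1" if "i \<in> {1..k}" for i
      using yi[OF that] that by (auto simp: I_set_def split: if_splits)
    ultimately show "y \<in> {y \<in> words k s. (\<forall>i\<in>I_set k x. y i = x i) \<and> (\<forall>i\<in>{1..k}. y i \<noteq> 1)}" by blast
  qed
  finally have "card (block k s t x) = (\<Prod>i\<in>{1..k}. card (?B i))" by (simp add: card_PiE)
  also have "\<dots> = (\<Prod>i\<in>{1..k} - I_set k x. s - 1)"
    by (rule prod.mono_neutral_cong_right) auto
  finally show ?thesis
    using card_Diff_subset[OF finite_I_set I_set_subset, of k x] by simp
qed

text \<open>Let \<open>d\<close> be \<open>t\<close> minus the weight of \<open>x\<close>. Up to a
  common sign the coefficients at words of weight \<open>t + 1\<close> and \<open>t + 2\<close> are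
  \<open>d choose d = 1\<close> and \<open>Suc d choose d = d + 1\<close>, so constancy forces
  \<open>d = 0\<close>. If \<open>k = t + 1\<close>, there is no weight \<open>t + 2\<close>, but
  the block sizes are powers of \<open>s - 1 \<ge> 2\<close> whose exponent
  \<open>k - card (I_set k x)\<close> reveals the weight.\<close>

lemma base_word_if_constant_weight:
  assumes x: "x \<in> low_words k s t" and x': "x' \<in> base_words k s t"
    and const: "\<And>y. y \<in> block k s t x \<Longrightarrow> oa_weight k s t x y = c"
    and card: "card (block k s t x) = card (block k s t x')"
  shows "x \<in> base_words k s t"
proof (cases "t + 1 < k")
  case True
  have xw: "x \<in> words k s" and xt: "card (I_set k x) \<le> t" using x by (auto simp: low_words_def)
  define d where "d = t - card (I_set k x)"
  have le: "card (I_set k x) \<le> t + 1" "t + 1 \<le> k" "card (I_set k x) \<le> t + 2" "t + 2 \<le> k"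
    using xt True by auto
  obtain y1 where y1: "y1 \<in> J_set k s x" "card (I_set k y1) = t + 1"
    by (rule exists_extension[OF s xw le(1,2)])
  obtain y2 where y2: "y2 \<in> J_set k s x" "card (I_set k y2) = t + 2"
    by (rule exists_extension[OF s xw le(3,4)])
  note y = y1 y2
  then have "y1 \<in> block k s t x" "y2 \<in> block k s t x" by (auto simp: block_def J_set_def Y_set_eq)
  then have "oa_weight k s t x y1 = oa_weight k s t x y2" using const by simp
  moreover have "t + 1 - card (I_set k x) - 1 = d" "t + 2 - card (I_set k x) - 1 = Suc d"
    using xt by (auto simp: d_def)
  ultimately have "(Suc d choose d) = 1"
    using y by (simp add: oa_weight_def d_def[symmetric])
  then have "d = 0" by simp
  then show ?thesis using xw xt by (simp add: base_words_def d_def)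
next
  case False
  then have kt: "k = t + 1" "2 < s" using t big by auto
  have "x' \<in> low_words k s t" using x' by (simp add: base_words_def low_words_def)
  then have "(s - 1) ^ (k - card (I_set k x)) = (s - 1) ^ (k - card (I_set k x'))"
    using card_block_full[OF x kt(1)] card_block_full[OF _ kt(1), of x'] card by simp
  then have "k - card (I_set k x) = k - card (I_set k x')"
    using kt(2) by (simp add: power_inject_exp)
  then show ?thesis using x x' t by (simp add: base_words_def low_words_def)
qed

text \<open>The coefficients of \<open>x\<close> are -1 on its block and 0 elsewhere, so the
  constraint \<open>x'\<close> delivered by \<open>facet_image\<close> is constant on its support,
  which is the preimage of that block.\<close>

lemma block_preimage:
  assumes \<sigma>: "\<sigma> \<in> coord_symmetries (Y_set k s t) (OAP k s t lam)" and "1 \<le> lam"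
    and x: "x \<in> base_words k s t"
  shows "\<exists>x'\<in>base_words k s t. \<sigma> ` block k s t x' = block k s t x"
proof -
  have perm: "\<sigma> permutes Y_set k s t" using \<sigma> by (simp add: coord_symmetries_def)
  have xl: "x \<in> low_words k s t" using x by (simp add: base_words_def low_words_def)
  obtain p where p: "p \<in> OAP k s t lam" "\<forall>y\<in>Y_set k s t. 0 < p y" "oa_slack k s t lam x p = 0"
    "\<forall>x'\<in>low_words k s t. x' \<noteq> x \<longrightarrow> 0 < oa_slack k s t lam x' p"
    by (rule exists_point_one_tight[OF s t(2) big \<open>1 \<le> lam\<close> xl])
  obtain y0 where y0: "y0 \<in> Y_set k s t" "y0 \<in> J_set k s x"
    using block_nonempty[OF xl] by (auto simp: block_def)
  have y0_weight: "oa_weight k s t x y0 \<noteq> 0" using oa_weight_base_word[OF x] y0(2) by simp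
  obtain x' r where x': "x' \<in> low_words k s t" "0 \<le> r"
    and r': "\<forall>y\<in>Y_set k s t. oa_weight k s t x' y = r * oa_weight k s t x (\<sigma> y)"
    by (rule facet_image[where b = "oa_const k s t lam" and A = "oa_weight k s t" and p = p
        and ?x0.0 = x, OF finite_Y_set finite_low_words \<sigma>[unfolded OAP_eq_polyhedron_of]
        p(1)[unfolded OAP_eq_polyhedron_of] p(2) p(3,4)[unfolded oa_slack_def] xl y0(1) y0_weight])
  note r = r'[rule_format]
  have in_x: "y \<in> block k s t x' \<Longrightarrow> \<sigma> y \<in> block k s t x" for y
    using r[of y] oa_weight_nonzero_iff[OF x'(1), of y] oa_weight_base_word[OF x] permutes_in_image[OF perm]
    by (auto simp: block_def split: if_splits)
  have const: "oa_weight k s t x' y = - r" if "y \<in> block k s t x'" for y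
    using r[of y] in_x[OF that] that oa_weight_base_word[OF x] by (auto simp: block_def)
  obtain y1 where "y1 \<in> block k s t x'" using block_nonempty[OF x'(1)] by blast
  \<comment> \<open>If \<open>r\<close> were 0, all coefficients of \<open>x'\<close> would vanish,
    although its block is nonempty.\<close>
  then have "r \<noteq> 0"
    using const oa_weight_nonzero_iff[OF x'(1), of y1] by (auto simp: block_def)
  then have from_x: "y \<in> block k s t x'" if "y \<in> Y_set k s t" "\<sigma> y \<in> block k s t x" for y
    using r[of y] oa_weight_nonzero_iff[OF x'(1), of y] oa_weight_base_word[OF x] that
    by (auto simp: block_def)
  have "\<sigma> ` block k s t x' = block k s t x"
  proof (intro equalityI subsetI)
    fix z assume z: "z \<in> block k s t x"
    then have "z \<in> Y_set k s t" by (simp add: block_def)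
    then obtain y where "y \<in> Y_set k s t" "z = \<sigma> y" using permutes_image[OF perm] by (metis imageE)
    then show "z \<in> \<sigma> ` block k s t x'" using from_x z by blast
  qed (use in_x in blast)
  moreover from this have "card (block k s t x') = card (block k s t x)"
    using card_image[OF inj_on_subset[OF permutes_inj[OF perm] subset_UNIV], of "block k s t x'"] by simp
  then have "x' \<in> base_words k s t"
    using base_word_if_constant_weight[OF x'(1) x const] by blast
  ultimately show ?thesis by blast
qed

text \<open>\<open>block_preimage\<close> gives one inclusion directly and the other one when
  applied to the inverse symmetry.\<close>

lemma coord_symmetry_imp_block_symmetry:
  assumes \<sigma>: "\<sigma> \<in> coord_symmetries (Y_set k s t) (OAP k s t lam)" and "1 \<le> lam"
  shows "block_symmetry k s t \<sigma>"
  unfolding block_symmetry_def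
proof (intro conjI equalityI subsetI)
  show perm: "\<sigma> permutes Y_set k s t" using \<sigma> by (simp add: coord_symmetries_def)
  fix B
  {
    assume "B \<in> block k s t ` base_words k s t"
    then show "B \<in> (`) \<sigma> ` block k s t ` base_words k s t"
      using block_preimage[OF \<sigma> \<open>1 \<le> lam\<close>] by fastforce
  next
    assume "B \<in> (`) \<sigma> ` block k s t ` base_words k s t"
    then obtain x where x: "x \<in> base_words k s t" "B = \<sigma> ` block k s t x" by blast
    obtain x' where x': "x' \<in> base_words k s t" "inv' \<sigma> ` block k s t x' = block k s t x"
      using block_preimage[OF inv_in_coord_symmetries[OF \<sigma>] \<open>1 \<le> lam\<close> x(1)] by blast
    have "B = block k s t x'"
      unfolding x(2) x'(2)[symmetric] by (simp add: image_image permutes_inverses[OF perm])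
    then show "B \<in> block k s t ` base_words k s t" using x'(1) by blast
  }
qed

section \<open>Invariants of block symmetries obtained by counting common blocks\<close>

lemma card_blocks_containing_both:
  assumes "y \<in> Y_set k s t" "y' \<in> Y_set k s t"
  shows "card {B \<in> block k s t ` base_words k s t. y \<in> B \<and> y' \<in> B}
       = card {i \<in> {1..k}. y i = y' i \<and> y i \<noteq> 1} choose t"
proof -
  let ?X = "{x \<in> base_words k s t. y \<in> J_set k s x \<and> y' \<in> J_set k s x}"
  have "{B \<in> block k s t ` base_words k s t. y \<in> B \<and> y' \<in> B} = block k s t ` ?X"
    using assms by (auto simp: block_def)
  moreover have "inj_on (block k s t) ?X" by (rule inj_on_subset[OF inj_on_block]) blast
  ultimately show ?thesis
    using card_base_words_below_both[of s y k y' t] s assms by (simp add: card_image Y_set_eq)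
qed

context
  fixes \<sigma> assumes \<sigma>: "block_symmetry k s t \<sigma>"
begin

lemma block_symmetry_permutes: "\<sigma> permutes Y_set k s t"
  using \<sigma> by (simp add: block_symmetry_def)

lemma block_symmetry_in_Y [simp]: "\<sigma> y \<in> Y_set k s t \<longleftrightarrow> y \<in> Y_set k s t"
  by (rule permutes_in_image[OF block_symmetry_permutes])

lemma block_symmetry_agreement_choose:
  assumes "y \<in> Y_set k s t" "y' \<in> Y_set k s t"
  shows "card {i \<in> {1..k}. \<sigma> y i = \<sigma> y' i \<and> \<sigma> y i \<noteq> 1} choose t
       = card {i \<in> {1..k}. y i = y' i \<and> y i \<noteq> 1} choose t"
proof -
  define \<B> where "\<B> = block k s t ` base_words k s t"
  have inj: "inj \<sigma>" by (rule permutes_inj[OF block_symmetry_permutes])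
  have im: "(`) \<sigma> ` \<B> = \<B>" using \<sigma> by (simp add: block_symmetry_def \<B>_def)
  have "{B \<in> \<B>. \<sigma> y \<in> B \<and> \<sigma> y' \<in> B} = (`) \<sigma> ` {B \<in> \<B>. y \<in> B \<and> y' \<in> B}"
  proof (intro equalityI subsetI)
    fix B assume B: "B \<in> {B \<in> \<B>. \<sigma> y \<in> B \<and> \<sigma> y' \<in> B}"
    then obtain B' where "B' \<in> \<B>" "B = \<sigma> ` B'" using im by blast
    then show "B \<in> (`) \<sigma> ` {B \<in> \<B>. y \<in> B \<and> y' \<in> B}"
      using B by (simp add: inj_image_mem_iff[OF inj])
  next
    fix B assume "B \<in> (`) \<sigma> ` {B \<in> \<B>. y \<in> B \<and> y' \<in> B}"
    then show "B \<in> {B \<in> \<B>. \<sigma> y \<in> B \<and> \<sigma> y' \<in> B}" using im by blast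
  qed
  moreover have "inj_on ((`) \<sigma>) {B \<in> \<B>. y \<in> B \<and> y' \<in> B}"
    by (rule inj_on_subset[OF _ subset_UNIV]) (simp add: inj_def inj_image_eq_iff[OF inj])
  ultimately have "card {B \<in> \<B>. \<sigma> y \<in> B \<and> \<sigma> y' \<in> B} = card {B \<in> \<B>. y \<in> B \<and> y' \<in> B}"
    by (simp add: card_image)
  then show ?thesis
    using assms by (simp add: card_blocks_containing_both \<B>_def)
qed

lemma block_symmetry_agreement:
  assumes "y \<in> Y_set k s t" "y' \<in> Y_set k s t" "t \<le> card {i \<in> {1..k}. y i = y' i \<and> y i \<noteq> 1}"
  shows "card {i \<in> {1..k}. \<sigma> y i = \<sigma> y' i \<and> \<sigma> y i \<noteq> 1} = card {i \<in> {1..k}. y i = y' i \<and> y i \<noteq> 1}"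
  using binomial_left_inject[OF t(1) assms(3) block_symmetry_agreement_choose[OF assms(1,2)]] .

text \<open>A word of \<open>Y_set\<close> agrees with itself on its support, which has more than
  \<open>t\<close> positions, so the binomial can be inverted.\<close>

lemma block_symmetry_weight:
  assumes "y \<in> Y_set k s t"
  shows "card (I_set k (\<sigma> y)) = card (I_set k y)"
  using block_symmetry_agreement[OF assms assms] assms by (simp add: I_set_def Y_set_eq)

lemma block_symmetry_image_test_words: "\<sigma> ` test_words k s = test_words k s"
proof (intro equalityI subsetI)
  have iff: "\<sigma> y \<in> test_words k s \<longleftrightarrow> y \<in> test_words k s" if "y \<in> Y_set k s t" for y
    using that block_symmetry_in_Y[of y] block_symmetry_weight[OF that]
    by (auto simp: test_words_def Y_set_eq)
  fix y
  {
    assume "y \<in> test_words k s"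
    moreover from this obtain z where "z \<in> Y_set k s t" "y = \<sigma> z"
      using test_words_subset permutes_image[OF block_symmetry_permutes] by blast
    ultimately show "y \<in> \<sigma> ` test_words k s" using iff by blast
  next
    assume "y \<in> \<sigma> ` test_words k s"
    then show "y \<in> test_words k s" using iff test_words_subset by blast
  }
qed

end

section \<open>Words are determined by their blocks, block symmetries by their values on test
  words\<close>

lemma Y_set_eqI:
  assumes "u \<in> Y_set k s t" "v \<in> Y_set k s t"
    and "\<And>x. x \<in> base_words k s t \<Longrightarrow> u \<in> J_set k s x \<longleftrightarrow> v \<in> J_set k s x"
  shows "u = v"
proof -
  have sub: "v i = u i" if uv: "u \<in> Y_set k s t" "v \<in> Y_set k s t" "i \<in> I_set k u"
    and imp: "\<And>x. x \<in> base_words k s t \<Longrightarrow> u \<in> J_set k s x \<Longrightarrow> v \<in> J_set k s x" for u v i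
  proof -
    \<comment> \<open>Because \<open>0 < t\<close> and the support of \<open>u\<close> has more than
      \<open>t\<close> positions, \<open>i\<close> lies in some \<open>t\<close>-subset of it, and
      the base word carried by this subset transfers the entry at \<open>i\<close> from
      \<open>u\<close> to \<open>v\<close>.\<close>
    obtain E where E: "{i} \<subseteq> E" "E \<subseteq> I_set k u" "card E = t"
      using exists_subset_between[of "{i}" t "I_set k u"] uv(1,3) t(1) by (auto simp: Y_set_eq)
    have "1 \<le> s" "u \<in> words k s" using s uv(1) by (auto simp: Y_set_eq)
    then obtain x where x: "x \<in> base_words k s t"
      "\<forall>v. v \<in> J_set k s x \<longleftrightarrow> v \<in> words k s \<and> (\<forall>i\<in>E. v i = u i)"
      by (rule exists_base_word[OF _ _ E(2,3)])
    then have "u \<in> J_set k s x" using uv(1) by (simp add: Y_set_eq)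
    then show ?thesis using imp[OF x(1)] x(2) E(1) by blast
  qed
  show ?thesis
  proof (rule words_eqI[of _ k s])
    fix i assume i: "i \<in> {1..k}"
    have uv: "v i = u i" if "i \<in> I_set k u"
      by (rule sub[OF assms(1,2) that]) (simp add: assms(3))
    have vu: "u i = v i" if "i \<in> I_set k v"
      by (rule sub[OF assms(2,1) that]) (simp add: assms(3))
    consider "i \<in> I_set k u" | "i \<in> I_set k v" | "u i = 1" "v i = 1"
      using i by (auto simp: I_set_def)
    then show "u i = v i" by cases (use uv vu in \<open>fastforce+\<close>)
  qed (use assms in \<open>auto simp: Y_set_eq\<close>)
qed

text \<open>Both maps preserve \<open>test_words\<close> and agree there, so the two images of a
  block have the same trace on the test words. A block is determined by this trace
  (\<open>base_words_eqI\<close>), so both maps act alike on blocks, and a word is determined by the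
  blocks containing it.\<close>

lemma block_symmetries_eqI:
  assumes \<sigma>: "block_symmetry k s t \<sigma>" and \<tau>: "block_symmetry k s t \<tau>"
    and eq: "\<And>y. y \<in> test_words k s \<Longrightarrow> \<sigma> y = \<tau> y"
  shows "\<sigma> = \<tau>"
proof
  have inj: "inj \<sigma>" "inj \<tau>"
    using permutes_inj block_symmetry_permutes \<sigma> \<tau> by blast+
  have im: "(`) \<sigma> ` block k s t ` base_words k s t = block k s t ` base_words k s t"
    "(`) \<tau> ` block k s t ` base_words k s t = block k s t ` base_words k s t"
    using \<sigma> \<tau> by (auto simp: block_symmetry_def)
  have blocks: "\<sigma> ` block k s t x = \<tau> ` block k s t x" if x: "x \<in> base_words k s t" for x
  proof -
    have "\<sigma> ` block k s t x \<in> (`) \<sigma> ` block k s t ` base_words k s t"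
      "\<tau> ` block k s t x \<in> (`) \<tau> ` block k s t ` base_words k s t"
      using x by blast+
    then have "\<sigma> ` block k s t x \<in> block k s t ` base_words k s t"
      "\<tau> ` block k s t x \<in> block k s t ` base_words k s t"
      by (simp_all only: im)
    then obtain x1 x2 where x1: "x1 \<in> base_words k s t" "\<sigma> ` block k s t x = block k s t x1"
      and x2: "x2 \<in> base_words k s t" "\<tau> ` block k s t x = block k s t x2"
      by blast
    have "block k s t x1 \<inter> test_words k s = \<sigma> ` (block k s t x \<inter> test_words k s)"
      by (simp add: image_Int[OF inj(1)] x1(2) block_symmetry_image_test_words[OF \<sigma>])
    also have "\<dots> = \<tau> ` (block k s t x \<inter> test_words k s)"
      using eq by (intro image_cong) auto
    also have "\<dots> = block k s t x2 \<inter> test_words k s"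
      by (simp add: image_Int[OF inj(2)] x2(2) block_symmetry_image_test_words[OF \<tau>])
    finally have "x1 = x2"
      using test_words_subset by (intro base_words_eqI x1 x2) (auto simp: block_def)
    then show ?thesis using x1 x2 by simp
  qed
  fix y
  show "\<sigma> y = \<tau> y"
  proof (cases "y \<in> Y_set k s t")
    case True
    show ?thesis
    proof (rule Y_set_eqI)
      show Y: "\<sigma> y \<in> Y_set k s t" "\<tau> y \<in> Y_set k s t"
        using True block_symmetry_in_Y \<sigma> \<tau> by blast+
      fix x assume "x \<in> base_words k s t"
      then have "block k s t x \<in> (`) \<sigma> ` block k s t ` base_words k s t"
        by (simp only: im imageI)
      then obtain x' where x': "x' \<in> base_words k s t" "\<sigma> ` block k s t x' = block k s t x"
        by blast
      have "\<sigma> y \<in> block k s t x \<longleftrightarrow> y \<in> block k s t x'"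
        unfolding x'(2)[symmetric] by (rule inj_image_mem_iff[OF inj(1)])
      also have "\<dots> \<longleftrightarrow> \<tau> y \<in> block k s t x"
        unfolding x'(2)[symmetric] blocks[OF x'(1)] by (rule inj_image_mem_iff[OF inj(2), symmetric])
      finally show "\<sigma> y \<in> J_set k s x \<longleftrightarrow> \<tau> y \<in> J_set k s x"
        using Y by (simp add: block_def)
    qed
  next
    case False
    then show ?thesis
      using permutes_not_in[OF block_symmetry_permutes[OF \<sigma>]] permutes_not_in[OF block_symmetry_permutes[OF \<tau>]]
      by simp
  qed
qed

end

section \<open>Automorphisms of Hamming graphs\<close>

lemma hdist_sym: "hdist k u v = hdist k v u"
  unfolding hdist_def by (rule arg_cong[where f = card]) auto

lemma hdist_triangle: "hdist k u v \<le> hdist k u w + hdist k w v"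
proof -
  have "hdist k u v \<le> card ({i \<in> {1..k}. u i \<noteq> w i} \<union> {i \<in> {1..k}. w i \<noteq> v i})"
    unfolding hdist_def by (rule card_mono) auto
  also have "\<dots> \<le> hdist k u w + hdist k w v"
    unfolding hdist_def by (rule card_Un_le)
  finally show ?thesis .
qed

lemma hdist_split:
  assumes "i \<in> {1..k}"
  shows "hdist k u v = card {j \<in> {1..k} - {i}. u j \<noteq> v j} + of_bool (u i \<noteq> v i)"
proof (cases "u i = v i")
  case True
  then have "{j \<in> {1..k}. u j \<noteq> v j} = {j \<in> {1..k} - {i}. u j \<noteq> v j}" by auto
  then show ?thesis using True by (simp add: hdist_def)
next
  case False
  then have "{j \<in> {1..k}. u j \<noteq> v j} = insert i {j \<in> {1..k} - {i}. u j \<noteq> v j}" using assms by auto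
  then show ?thesis using False by (simp add: hdist_def)
qed

text \<open>The additive form covers increase, decrease and equality at once and avoids subtraction
  of natural numbers.\<close>

lemma hdist_fun_upd:
  assumes "i \<in> {1..k}"
  shows "hdist k u (w(i := b)) + of_bool (u i \<noteq> w i) = hdist k u w + of_bool (u i \<noteq> b)"
proof -
  have "{j \<in> {1..k} - {i}. u j \<noteq> (w(i := b)) j} = {j \<in> {1..k} - {i}. u j \<noteq> w j}" by auto
  then show ?thesis
    unfolding hdist_split[OF assms, of u] by simp
qed

lemma hdist_self [simp]: "hdist k u u = 0"
  by (simp add: hdist_def)

context
  fixes k :: nat and A :: "nat set" and V :: "(nat \<Rightarrow> nat) set"
  assumes V_def: "V = {1..k} \<rightarrow>\<^sub>E A"
begin

lemma V_eqI: "u \<in> V \<Longrightarrow> v \<in> V \<Longrightarrow> (\<And>i. i \<in> {1..k} \<Longrightarrow> u i = v i) \<Longrightarrow> u = v"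
  unfolding V_def by (rule PiE_ext)

lemma V_mem: "u \<in> V \<Longrightarrow> i \<in> {1..k} \<Longrightarrow> u i \<in> A"
  unfolding V_def by (rule PiE_mem)

lemma V_upd: "u \<in> V \<Longrightarrow> i \<in> {1..k} \<Longrightarrow> a \<in> A \<Longrightarrow> u(i := a) \<in> V"
  unfolding V_def PiE_iff extensional_def by simp

lemma hdist_eq_0_V:
  assumes "u \<in> V" "v \<in> V"
  shows "hdist k u v = 0 \<longleftrightarrow> u = v"
proof
  assume "hdist k u v = 0"
  then have "{i \<in> {1..k}. u i \<noteq> v i} = {}" by (simp add: hdist_def)
  then have "u i = v i" if "i \<in> {1..k}" for i using that by blast
  then show "u = v" by (rule V_eqI[OF assms])
qed simp

lemma hdist_eq_1_V:
  assumes "u \<in> V" "v \<in> V" "hdist k u v = 1"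
  obtains j where "j \<in> {1..k}" "u j \<noteq> v j" "v = u(j := v j)"
proof -
  obtain j where j: "{i \<in> {1..k}. u i \<noteq> v i} = {j}"
    by (rule card_1_singletonE[OF assms(3)[unfolded hdist_def]])
  then have jk: "j \<in> {1..k}" "u j \<noteq> v j" by blast+
  have "v = u(j := v j)"
  proof (rule V_eqI[OF assms(2) V_upd[OF assms(1) jk(1) V_mem[OF assms(2) jk(1)]]])
    fix i assume "i \<in> {1..k}"
    then have "i = j \<or> u i = v i" using j by blast
    then show "v i = (u(j := v j)) i" by auto
  qed
  then show thesis using that jk by blast
qed

lemma hdist_step:
  assumes "u \<in> V" "v \<in> V" "hdist k u v = Suc n"
  obtains w where "w \<in> V" "hdist k u w = 1" "hdist k w v = n"
proof -
  have "{i \<in> {1..k}. u i \<noteq> v i} \<noteq> {}" using assms(3) unfolding hdist_def by (metis card.empty nat.distinct(1))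
  then obtain i where i: "i \<in> {1..k}" "u i \<noteq> v i" by blast
  show thesis
  proof (rule that)
    show "u(i := v i) \<in> V" using V_upd V_mem assms i by blast
    show "hdist k u (u(i := v i)) = 1" using hdist_fun_upd[OF i(1), of u u "v i"] i by simp
    show "hdist k (u(i := v i)) v = n"
      using hdist_fun_upd[OF i(1), of v u "v i"] i assms(3) by (simp add: hdist_sym[of k _ v])
  qed
qed

text \<open>Shortest paths are carried to walks of the same length. For a graph automorphism this
  applies to the inverse too, which makes it an isometry.\<close>

lemma hdist_contraction:
  assumes "\<And>u. u \<in> V \<Longrightarrow> f u \<in> V"
    and "\<And>u v. u \<in> V \<Longrightarrow> v \<in> V \<Longrightarrow> hdist k u v = 1 \<Longrightarrow> hdist k (f u) (f v) = 1"
    and "u \<in> V" "v \<in> V"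
  shows "hdist k (f u) (f v) \<le> hdist k u v"
  using assms(3)
proof (induction "hdist k u v" arbitrary: u)
  case 0
  then show ?case using hdist_eq_0_V[of u v] assms(4) by simp
next
  case (Suc n)
  obtain w where w: "w \<in> V" "hdist k u w = 1" "hdist k w v = n"
    by (rule hdist_step[OF Suc.prems assms(4) Suc.hyps(2)[symmetric]])
  have "hdist k (f u) (f v) \<le> hdist k (f u) (f w) + hdist k (f w) (f v)" by (rule hdist_triangle)
  also have "hdist k (f u) (f w) = 1" by (rule assms(2)[OF Suc.prems w(1,2)])
  also have "hdist k (f w) (f v) \<le> n" using Suc.hyps(1)[OF w(3)[symmetric] w(1)] w(3) by simp
  finally show ?case using Suc.hyps(2) by simp
qed

text \<open>The words differing from a base word \<open>o'\<close> at most in coordinate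
  \<open>i\<close> are pairwise adjacent, so their images lie on a single axis
  \<open>\<tau> i\<close> through \<open>f o'\<close>. A coordinate of an arbitrary word is visible
  in its distances to the points of the corresponding axis, and an isometry preserves these
  distances.\<close>

theorem hamming_automorphism:
  assumes bij: "bij_betw f V V"
    and adj: "\<forall>u\<in>V. \<forall>v\<in>V. hdist k (f u) (f v) = 1 \<longleftrightarrow> hdist k u v = 1"
    and A: "finite A" "2 \<le> card A"
  obtains \<pi> g where "\<pi> permutes {1..k}" "\<forall>i\<in>{1..k}. g i permutes A" "\<forall>v\<in>V. f v = word_map k g \<pi> v"
proof -
  have fV: "f u \<in> V" if "u \<in> V" for u using bij_betwE[OF bij] that by blast
  have inj: "f u = f v \<longleftrightarrow> u = v" if "u \<in> V" "v \<in> V" for u v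
    using bij that by (auto simp: bij_betw_def inj_on_def)
  have iso: "hdist k (f u) (f v) = hdist k u v" if "u \<in> V" "v \<in> V" for u v
  proof (rule antisym)
    show "hdist k (f u) (f v) \<le> hdist k u v"
      using adj fV that by (intro hdist_contraction) auto
    let ?h = "inv_into V f"
    have h: "?h w \<in> V" "f (?h w) = w" if "w \<in> V" for w
      using that bij by (auto simp: bij_betw_def inv_into_into f_inv_into_f)
    have "hdist k (?h (f u)) (?h (f v)) \<le> hdist k (f u) (f v)"
      using adj h fV that by (intro hdist_contraction) metis+
    then show "hdist k u v \<le> hdist k (f u) (f v)"
      using bij that by (simp add: bij_betw_def inv_into_f_f)
  qed
  have "A \<noteq> {}" using A(2) by auto
  then obtain a0 where a0: "a0 \<in> A" by blast
  define o' where "o' = (\<lambda>i\<in>{1..k}. a0)"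
  have oV: "o' \<in> V" using a0 by (auto simp: o'_def V_def)
  have "\<exists>a1. a1 \<in> A \<and> a1 \<noteq> a0"
  proof (rule ccontr)
    assume "\<not> (\<exists>a1. a1 \<in> A \<and> a1 \<noteq> a0)"
    then have "A \<subseteq> {a0}" by blast
    then show False using card_mono[of "{a0}" A] A(2) by simp
  qed
  then obtain a1 where a1: "a1 \<in> A" "a1 \<noteq> a0" by blast
  have e: "o'(i := a) \<in> V" if "i \<in> {1..k}" "a \<in> A" for i a using V_upd[OF oV that] .
  have "\<exists>j\<in>{1..k}. \<forall>a\<in>A. f (o'(i := a)) = (f o')(j := f (o'(i := a)) j)" if i: "i \<in> {1..k}" for i
  proof -
    have oi: "o' i = a0" using i by (simp add: o'_def)
    have d1: "hdist k (f o') (f (o'(i := a))) = 1" if "a \<in> A" "a \<noteq> a0" for a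
      using iso[OF oV e[OF i that(1)]] hdist_fun_upd[OF i, of o' o' a] that oi by simp
    obtain j where j: "j \<in> {1..k}" "f o' j \<noteq> f (o'(i := a1)) j" "f (o'(i := a1)) = (f o')(j := f (o'(i := a1)) j)"
      by (rule hdist_eq_1_V[OF fV[OF oV] fV[OF e[OF i a1(1)]] d1[OF a1]])
    have "f (o'(i := a)) = (f o')(j := f (o'(i := a)) j)" if a: "a \<in> A" for a
    proof (cases "a = a0")
      case True
      then have "o'(i := a) = o'" using oi by auto
      then show ?thesis by simp
    next
      case False
      obtain j' where j': "j' \<in> {1..k}" "f o' j' \<noteq> f (o'(i := a)) j'" "f (o'(i := a)) = (f o')(j' := f (o'(i := a)) j')"
        by (rule hdist_eq_1_V[OF fV[OF oV] fV[OF e[OF i a]] d1[OF a False]])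
      \<comment> \<open>Points other than \<open>f o'\<close> on two different axes through it
        differ in two coordinates, while two points of the axis \<open>i\<close> through
        \<open>o'\<close> have distance at most 1.\<close>
      have "j' = j"
      proof (rule ccontr)
        assume ne: "j' \<noteq> j"
        have "hdist k (f (o'(i := a1))) (f (o'(i := a))) = hdist k (o'(i := a1)) (o'(i := a))"
          by (rule iso[OF e[OF i a1(1)] e[OF i a]])
        also have "\<dots> \<le> 1"
          using hdist_fun_upd[OF i, of "o'(i := a1)" "o'(i := a1)" a] by (auto split: if_splits)
        finally have "hdist k (f (o'(i := a1))) (f (o'(i := a))) \<le> 1" .
        moreover have "f (o'(i := a1)) j \<noteq> f (o'(i := a)) j"
          using j(2) fun_cong[OF j'(3), of j] ne by simp
        moreover have "f (o'(i := a1)) j' \<noteq> f (o'(i := a)) j'"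
          using j'(2) fun_cong[OF j(3), of j'] ne by simp
        ultimately have "card {j, j'} \<le> 1"
          using card_mono[of "{l \<in> {1..k}. f (o'(i := a1)) l \<noteq> f (o'(i := a)) l}" "{j, j'}"] j(1) j'(1)
          by (simp add: hdist_def)
        then show False using ne by simp
      qed
      then show ?thesis using j'(3) by simp
    qed
    then show ?thesis using j(1) by blast
  qed
  then have "\<forall>i\<in>{1..k}. \<exists>j. j \<in> {1..k} \<and> (\<forall>a\<in>A. f (o'(i := a)) = (f o')(j := f (o'(i := a)) j))"
    by blast
  then obtain \<tau> where \<tau>':
    "\<forall>i\<in>{1..k}. \<tau> i \<in> {1..k} \<and> (\<forall>a\<in>A. f (o'(i := a)) = (f o')(\<tau> i := f (o'(i := a)) (\<tau> i)))"
    by (rule bchoice[THEN exE])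
  have \<tau>: "\<tau> i \<in> {1..k}" "a \<in> A \<Longrightarrow> f (o'(i := a)) = (f o')(\<tau> i := f (o'(i := a)) (\<tau> i))"
    if "i \<in> {1..k}" for i a
    using \<tau>'[rule_format, OF that] by (rule conjunct1, rule conjunct2[THEN bspec])
  \<comment> \<open>Otherwise two points of different axes through \<open>o'\<close>, at distance 2,
    would be sent to one axis, where distances are at most 1.\<close>
  have \<tau>_inj: "inj_on \<tau> {1..k}"
  proof (rule inj_onI, rule ccontr)
    fix i i' assume i: "i \<in> {1..k}" "i' \<in> {1..k}" "\<tau> i = \<tau> i'" "i \<noteq> i'"
    have oi: "o' i = a0" "o' i' = a0" using i by (auto simp: o'_def)
    have "hdist k (o'(i := a1)) o' = 1"
      using hdist_fun_upd[OF i(1), of o' o' a1] oi a1 by (simp add: hdist_sym[of k _ o'])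
    then have "hdist k (o'(i := a1)) (o'(i' := a1)) = 2"
      using hdist_fun_upd[OF i(2), of "o'(i := a1)" o' a1] oi a1 i(4) by simp
    moreover have "hdist k (f (o'(i := a1))) (f (o'(i' := a1))) \<le> 1"
    proof -
      have "f (o'(i' := a1)) = (f (o'(i := a1)))(\<tau> i := f (o'(i' := a1)) (\<tau> i))"
        using \<tau>(2)[OF i(1) a1(1)] \<tau>(2)[OF i(2) a1(1)] i(3) by (metis fun_upd_upd)
      then show ?thesis
        using hdist_fun_upd[OF \<tau>(1)[OF i(1)], of "f (o'(i := a1))" "f (o'(i := a1))" "f (o'(i' := a1)) (\<tau> i)"]
        by (metis add.right_neutral add_cancel_left_left hdist_self of_bool_def zero_le_one order.refl)
    qed
    ultimately show False using iso[OF e[OF i(1) a1(1)] e[OF i(2) a1(1)]] by simp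
  qed
  have \<tau>_bij: "bij_betw \<tau> {1..k} {1..k}"
  proof -
    have "\<tau> ` {1..k} \<subseteq> {1..k}" using \<tau>(1) by blast
    then show ?thesis using endo_inj_surj[OF _ _ \<tau>_inj] \<tau>_inj by (simp add: bij_betw_def)
  qed
  define \<gamma> where "\<gamma> = (\<lambda>i a. f (o'(i := a)) (\<tau> i))"
  have main: "f v (\<tau> i) = \<gamma> i (v i)" if v: "v \<in> V" and i: "i \<in> {1..k}" for v i
  proof -
    let ?j = "\<tau> i"
    have oi: "o' i = a0" using i by (simp add: o'_def)
    \<comment> \<open>\<open>upd\<close> and \<open>key\<close> express the same change of distance,
      once by \<open>v i\<close> and once by coordinate \<open>\<tau> i\<close> of
      \<open>f v\<close>. If \<open>v i \<noteq> a0\<close>, passing from \<open>a0\<close> to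
      \<open>v i\<close> decreases the distance, which forces
      \<open>f v (\<tau> i) = \<gamma> i (v i)\<close>. If \<open>v i = a0\<close>, passing to
      \<open>a1\<close> increases it, which forces agreement with \<open>f o'\<close>.\<close>
    have key: "hdist k v (o'(i := a)) + of_bool (f v ?j \<noteq> f o' ?j) = hdist k v o' + of_bool (f v ?j \<noteq> \<gamma> i a)"
      if a: "a \<in> A" for a
    proof -
      have "hdist k v (o'(i := a)) = hdist k (f v) ((f o')(?j := \<gamma> i a))"
        using iso[OF v e[OF i a]] \<tau>(2)[OF i a] by (simp add: \<gamma>_def)
      then show ?thesis
        using hdist_fun_upd[OF \<tau>(1)[OF i], of "f v" "f o'" "\<gamma> i a"] iso[OF v oV] by simp
    qed
    have upd: "hdist k v (o'(i := a)) + of_bool (v i \<noteq> a0) = hdist k v o' + of_bool (v i \<noteq> a)" for a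
      using hdist_fun_upd[OF i, of v o' a] oi by simp
    show ?thesis
    proof (cases "v i = a0")
      case True
      then have "o'(i := v i) = o'" using oi by auto
      then have "\<gamma> i (v i) = f o' ?j" by (simp add: \<gamma>_def)
      moreover have "f v ?j = f o' ?j"
        using key[OF a1(1)] upd[of a1] True a1(2) by (auto simp: of_bool_def split: if_splits)
      ultimately show ?thesis by simp
    next
      case False
      then show ?thesis
        using key[OF V_mem[OF v i]] upd[of "v i"] by (auto simp: of_bool_def split: if_splits)
    qed
  qed
  have \<gamma>_bij: "bij_betw (\<gamma> i) A A" if i: "i \<in> {1..k}" for i
  proof -
    have "inj_on (\<gamma> i) A"
    proof (rule inj_onI)
      fix a b assume ab: "a \<in> A" "b \<in> A" "\<gamma> i a = \<gamma> i b"
      then have "f (o'(i := a)) = f (o'(i := b))"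
        using \<tau>(2)[OF i ab(1)] \<tau>(2)[OF i ab(2)] by (simp add: \<gamma>_def)
      then have "o'(i := a) = o'(i := b)" using inj[OF e[OF i ab(1)] e[OF i ab(2)]] by simp
      then show "a = b" by (metis fun_upd_same)
    qed
    moreover have "\<gamma> i ` A \<subseteq> A"
      using V_mem[OF fV[OF e[OF i]] \<tau>(1)[OF i]] by (auto simp: \<gamma>_def)
    ultimately show ?thesis using endo_inj_surj[OF A(1)] by (simp add: bij_betw_def)
  qed
  define \<tau>' where "\<tau>' = (\<lambda>i. if i \<in> {1..k} then \<tau> i else i)"
  have \<tau>': "\<tau>' permutes {1..k}"
  proof (rule bij_imp_permutes)
    show "bij_betw \<tau>' {1..k} {1..k}"
      by (rule bij_betw_cong[THEN iffD1, OF _ \<tau>_bij]) (simp add: \<tau>'_def)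
  qed (auto simp: \<tau>'_def)
  \<comment> \<open>\<open>main\<close> sends coordinate \<open>i\<close> to position
    \<open>\<tau> i\<close>, whereas \<open>word_map\<close> asks for the source of each output
    position.\<close>
  define \<pi> where "\<pi> = inv' \<tau>'"
  have \<pi>: "\<pi> permutes {1..k}" unfolding \<pi>_def by (rule permutes_inv[OF \<tau>'])
  have \<pi>_in: "\<pi> i \<in> {1..k}" if "i \<in> {1..k}" for i
    using that by (simp only: permutes_in_image[OF \<pi>])
  have \<tau>\<pi>: "\<tau> (\<pi> i) = i" if "i \<in> {1..k}" for i
  proof -
    have "\<tau>' (\<pi> i) = i" unfolding \<pi>_def by (rule permutes_inverses(1)[OF \<tau>'])
    then show ?thesis using \<pi>_in[OF that] by (simp only: \<tau>'_def if_True)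
  qed
  define g where "g = (\<lambda>i a. if a \<in> A then \<gamma> (\<pi> i) a else a)"
  have g: "g i permutes A" if "i \<in> {1..k}" for i
  proof (rule bij_imp_permutes)
    show "bij_betw (g i) A A"
      by (rule bij_betw_cong[THEN iffD1, OF _ \<gamma>_bij[OF \<pi>_in[OF that]]]) (simp add: g_def)
  qed (simp add: g_def)
  have "f v = word_map k g \<pi> v" if v: "v \<in> V" for v
  proof
    fix i
    show "f v i = word_map k g \<pi> v i"
    proof (cases "i \<in> {1..k}")
      case True
      then show ?thesis
        using main[OF v \<pi>_in[OF True]] V_mem[OF v \<pi>_in[OF True]] \<tau>\<pi>[OF True] by (simp add: word_map_def g_def)
    next
      case False
      have "f v i = undefined" using fV[OF v] False unfolding V_def by (rule PiE_arb)
      then show ?thesis using False by (auto simp: word_map_def)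
    qed
  qed
  then have "\<forall>v\<in>V. f v = word_map k g \<pi> v" by (rule ballI)
  moreover have "\<forall>i\<in>{1..k}. g i permutes A" using g by (rule ballI)
  ultimately show thesis by (intro that[OF \<pi>])
qed

end

section \<open>Induced permutations\<close>

definition induced_perm :: "nat \<Rightarrow> nat \<Rightarrow> nat \<Rightarrow> (nat \<Rightarrow> nat \<Rightarrow> nat) \<Rightarrow> (nat \<Rightarrow> nat) \<Rightarrow> (nat \<Rightarrow> nat) \<Rightarrow> nat \<Rightarrow> nat" where
  "induced_perm k s t g \<pi> = (\<lambda>y. if y \<in> Y_set k s t then word_map k g \<pi> y else y)"

lemma induced_perms_eq:
  "induced_perms k s t =
     {induced_perm k s t g \<pi> | g \<pi>. \<pi> permutes {1..k} \<and> (\<forall>i\<in>{1..k}. g i permutes {2..s})}"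
  unfolding induced_perms_def induced_perm_def by blast

lemma word_map_apply: "i \<in> {1..k} \<Longrightarrow> word_map k g \<pi> x i = g i (x (\<pi> i))"
  by (simp add: word_map_def)

lemma word_map_out: "i \<notin> {1..k} \<Longrightarrow> word_map k g \<pi> x i = undefined"
  unfolding word_map_def by (rule restrict_apply[THEN trans]) (rule if_not_P)

lemma word_map_cong:
  "(\<And>i. i \<in> {1..k} \<Longrightarrow> g i = h i) \<Longrightarrow> word_map k g \<pi> x = word_map k h \<pi> x"
  unfolding word_map_def by (intro restrict_ext) simp

text \<open>Positions are permuted by precomposition, so these permutations compose in reverse
  order, and the inner level permutation is the one at the position \<open>\<pi> i\<close> that is
  read.\<close>

lemma word_map_comp:
  assumes "\<pi> permutes {1..k}"
  shows "word_map k g \<pi> (word_map k h \<rho> x) = word_map k (\<lambda>i. g i \<circ> h (\<pi> i)) (\<rho> \<circ> \<pi>) x"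
  unfolding word_map_def[of k g] word_map_def[of k "\<lambda>i. g i \<circ> h (\<pi> i)"]
  by (intro restrict_ext) (simp only: word_map_apply permutes_in_image[OF assms] o_apply)

context
  fixes k s :: nat and g :: "nat \<Rightarrow> nat \<Rightarrow> nat" and \<pi> :: "nat \<Rightarrow> nat"
  assumes \<pi>: "\<pi> permutes {1..k}" and g: "\<forall>i\<in>{1..k}. g i permutes {2..s}" and s: "1 \<le> s"
begin

lemma level_eq_iff: "i \<in> {1..k} \<Longrightarrow> g i a = g i b \<longleftrightarrow> a = b"
  using g permutes_inj inj_eq by metis

lemma level_eq_1_iff: "i \<in> {1..k} \<Longrightarrow> g i a = 1 \<longleftrightarrow> a = 1"
proof -
  assume i: "i \<in> {1..k}"
  then have "g i 1 = 1" using g by (intro permutes_not_in[of _ "{2..s}"]) auto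
  then show ?thesis using level_eq_iff[OF i, of a 1] by simp
qed

lemma word_map_in_words:
  assumes "x \<in> words k s"
  shows "word_map k g \<pi> x \<in> words k s"
proof (rule wordsI)
  fix i assume i: "i \<in> {1..k}"
  have "g i permutes {2..s}" using g i by blast
  then have "g i permutes {1..s}" by (rule permutes_subset) auto
  moreover have "x (\<pi> i) \<in> {1..s}"
    using i by (intro words_in[OF assms]) (simp only: permutes_in_image[OF \<pi>])
  ultimately show "word_map k g \<pi> x i \<in> {1..s}"
    using i by (simp only: word_map_apply permutes_in_image)
qed (rule word_map_out)

lemma I_set_word_map: "\<pi> ` I_set k (word_map k g \<pi> x) = I_set k x"
proof (intro equalityI subsetI)
  fix j assume "j \<in> \<pi> ` I_set k (word_map k g \<pi> x)"
  then obtain i where i: "i \<in> {1..k}" "word_map k g \<pi> x i \<noteq> 1" "j = \<pi> i" by (auto simp: I_set_def)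
  then have "x j \<noteq> 1" by (simp only: word_map_apply level_eq_1_iff) simp
  moreover have "j \<in> {1..k}" using i by (simp only: permutes_in_image[OF \<pi>])
  ultimately show "j \<in> I_set k x" by (simp add: I_set_def)
next
  fix j assume j: "j \<in> I_set k x"
  define i where "i = inv' \<pi> j"
  have ij: "j = \<pi> i" unfolding i_def by (simp add: permutes_inverses[OF \<pi>])
  have i: "i \<in> {1..k}" using j permutes_in_image[OF \<pi>, of i] ij by (auto simp: I_set_def)
  have "word_map k g \<pi> x i \<noteq> 1"
    using j ij i by (simp only: word_map_apply level_eq_1_iff) (simp add: I_set_def)
  then show "j \<in> \<pi> ` I_set k (word_map k g \<pi> x)" using i ij by (auto simp: I_set_def)
qed

lemma card_I_set_word_map: "card (I_set k (word_map k g \<pi> x)) = card (I_set k x)"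
  using card_image[OF inj_on_subset[OF permutes_inj[OF \<pi>] subset_UNIV], of "I_set k (word_map k g \<pi> x)"]
  by (simp only: I_set_word_map)

lemma word_map_in_J_set_iff:
  assumes "x \<in> words k s" "y \<in> words k s"
  shows "word_map k g \<pi> y \<in> J_set k s (word_map k g \<pi> x) \<longleftrightarrow> y \<in> J_set k s x"
proof -
  have "word_map k g \<pi> y i = word_map k g \<pi> x i \<longleftrightarrow> y (\<pi> i) = x (\<pi> i)" if "i \<in> {1..k}" for i
    using that by (simp only: word_map_apply level_eq_iff)
  then have "(\<forall>i\<in>I_set k (word_map k g \<pi> x). word_map k g \<pi> y i = word_map k g \<pi> x i)
      \<longleftrightarrow> (\<forall>i\<in>I_set k (word_map k g \<pi> x). y (\<pi> i) = x (\<pi> i))"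
    using I_set_subset by blast
  also have "\<dots> \<longleftrightarrow> (\<forall>j\<in>\<pi> ` I_set k (word_map k g \<pi> x). y j = x j)" by blast
  finally show ?thesis
    using assms(2) word_map_in_words[OF assms(2)] by (simp add: J_set_def I_set_word_map)
qed

lemma word_map_in_Y_set: "y \<in> Y_set k s t \<Longrightarrow> word_map k g \<pi> y \<in> Y_set k s t"
  using word_map_in_words card_I_set_word_map by (simp add: Y_set_eq)

lemma word_map_inverse:
  assumes "x \<in> words k s"
  shows "word_map k (\<lambda>i. inv' (g (inv' \<pi> i))) (inv' \<pi>) (word_map k g \<pi> x) = x"
    "word_map k g \<pi> (word_map k (\<lambda>i. inv' (g (inv' \<pi> i))) (inv' \<pi>) x) = x"
proof -
  have \<pi>': "inv' \<pi> permutes {1..k}" by (rule permutes_inv[OF \<pi>])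
  show "word_map k (\<lambda>i. inv' (g (inv' \<pi> i))) (inv' \<pi>) (word_map k g \<pi> x) = x"
  proof
    fix i
    show "word_map k (\<lambda>i. inv' (g (inv' \<pi> i))) (inv' \<pi>) (word_map k g \<pi> x) i = x i"
    proof (cases "i \<in> {1..k}")
      case True
      then have "inv' \<pi> i \<in> {1..k}" by (simp only: permutes_in_image[OF \<pi>'])
      moreover from this have "g (inv' \<pi> i) permutes {2..s}" using g by blast
      ultimately show ?thesis
        using True by (simp only: word_map_apply permutes_inverses[OF \<pi>] permutes_inverses)
    next
      case False
      show ?thesis using word_map_out[OF False] words_out[OF assms False] by simp
    qed
  qed
  show "word_map k g \<pi> (word_map k (\<lambda>i. inv' (g (inv' \<pi> i))) (inv' \<pi>) x) = x"
  proof
    fix i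
    show "word_map k g \<pi> (word_map k (\<lambda>i. inv' (g (inv' \<pi> i))) (inv' \<pi>) x) i = x i"
    proof (cases "i \<in> {1..k}")
      case True
      then have "\<pi> i \<in> {1..k}" by (simp only: permutes_in_image[OF \<pi>])
      moreover have "g i permutes {2..s}" using g True by blast
      ultimately show ?thesis
        using True by (simp only: word_map_apply permutes_inverses[OF \<pi>] permutes_inverses)
    next
      case False
      show ?thesis using word_map_out[OF False] words_out[OF assms False] by simp
    qed
  qed
qed

lemma oa_weight_word_map:
  assumes "x \<in> words k s" "y \<in> words k s"
  shows "oa_weight k s t (word_map k g \<pi> x) (word_map k g \<pi> y) = oa_weight k s t x y"
  by (simp add: oa_weight_def card_I_set_word_map word_map_in_J_set_iff[OF assms])

end

lemma inverse_params:
  assumes "\<pi> permutes {1..k}" "\<forall>i\<in>{1..k}. g i permutes {2..s}"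
  shows "inv' \<pi> permutes {1..k}" "\<forall>i\<in>{1..k}. inv' (g (inv' \<pi> i)) permutes {2..s}"
proof -
  show 1: "inv' \<pi> permutes {1..k}" by (rule permutes_inv[OF assms(1)])
  show "\<forall>i\<in>{1..k}. inv' (g (inv' \<pi> i)) permutes {2..s}"
  proof
    fix i assume "i \<in> {1..k}"
    then have "inv' \<pi> i \<in> {1..k}" by (simp only: permutes_in_image[OF 1])
    then show "inv' (g (inv' \<pi> i)) permutes {2..s}" using assms(2) by (intro permutes_inv) blast
  qed
qed

lemma induced_perm_permutes:
  assumes "\<pi> permutes {1..k}" "\<forall>i\<in>{1..k}. g i permutes {2..s}" "1 \<le> s"
  shows "induced_perm k s t g \<pi> permutes Y_set k s t"
proof (rule bij_imp_permutes)
  let ?w = "word_map k (\<lambda>i. inv' (g (inv' \<pi> i))) (inv' \<pi>)"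
  have "bij_betw (word_map k g \<pi>) (Y_set k s t) (Y_set k s t)"
  proof (rule bij_betw_byWitness[where f' = ?w])
    show "\<forall>y\<in>Y_set k s t. ?w (word_map k g \<pi> y) = y" "\<forall>y\<in>Y_set k s t. word_map k g \<pi> (?w y) = y"
      by (simp_all add: Y_set_eq word_map_inverse[OF assms])
    show "word_map k g \<pi> ` Y_set k s t \<subseteq> Y_set k s t"
      by (intro image_subsetI word_map_in_Y_set[OF assms])
    show "?w ` Y_set k s t \<subseteq> Y_set k s t"
      by (intro image_subsetI word_map_in_Y_set[OF inverse_params[OF assms(1,2)] assms(3)])
  qed
  then show "bij_betw (induced_perm k s t g \<pi>) (Y_set k s t) (Y_set k s t)"
    by (rule bij_betw_cong[THEN iffD1, rotated]) (simp add: induced_perm_def)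
qed (simp add: induced_perm_def)

lemma inv_induced_perm:
  assumes "\<pi> permutes {1..k}" "\<forall>i\<in>{1..k}. g i permutes {2..s}" "1 \<le> s"
  shows "inv' (induced_perm k s t g \<pi>) = induced_perm k s t (\<lambda>i. inv' (g (inv' \<pi> i))) (inv' \<pi>)"
proof (rule inv_unique_comp)
  show "induced_perm k s t g \<pi> \<circ> induced_perm k s t (\<lambda>i. inv' (g (inv' \<pi> i))) (inv' \<pi>) = id"
    using word_map_inverse(2)[OF assms] word_map_in_Y_set[OF inverse_params[OF assms(1,2)] assms(3)]
    by (auto simp: induced_perm_def fun_eq_iff Y_set_eq)
  show "induced_perm k s t (\<lambda>i. inv' (g (inv' \<pi> i))) (inv' \<pi>) \<circ> induced_perm k s t g \<pi> = id"
    using word_map_inverse(1)[OF assms] word_map_in_Y_set[OF assms]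
    by (auto simp: induced_perm_def fun_eq_iff Y_set_eq)
qed

lemma coord_symmetriesI:
  assumes \<sigma>: "\<sigma> permutes Y" and "\<And>N. N \<in> P \<Longrightarrow> N \<circ> \<sigma> \<in> P" "\<And>N. N \<in> P \<Longrightarrow> N \<circ> inv' \<sigma> \<in> P"
  shows "\<sigma> \<in> coord_symmetries Y P"
proof -
  have "N \<in> (\<lambda>N. N \<circ> \<sigma>) ` P" if "N \<in> P" for N
    using assms(3)[OF that] by (intro image_eqI[of _ _ "N \<circ> inv' \<sigma>"]) (simp_all add: comp_assoc permutes_inv_o[OF \<sigma>])
  then show ?thesis using assms(1,2) by (auto simp: coord_symmetries_def)
qed

text \<open>The word map acts on low words as well and preserves weights and membership in
  \<open>J_set\<close>. Hence the slack of \<open>x\<close> at the permuted point is the slack of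
  \<open>word_map k g \<pi> x\<close> at \<open>N\<close>.\<close>

lemma OAP_comp_induced_perm:
  assumes "\<pi> permutes {1..k}" "\<forall>i\<in>{1..k}. g i permutes {2..s}" "1 \<le> s" and N: "N \<in> OAP k s t lam"
  shows "N \<circ> induced_perm k s t g \<pi> \<in> OAP k s t lam"
proof -
  let ?\<sigma> = "induced_perm k s t g \<pi>"
  have perm: "?\<sigma> permutes Y_set k s t" by (rule induced_perm_permutes[OF assms(1-3)])
  have Next: "N \<in> extensional (Y_set k s t)" and Npos: "\<forall>y\<in>Y_set k s t. 0 \<le> N y"
    and Nslack: "\<forall>x\<in>low_words k s t. 0 \<le> oa_const k s t lam x + (\<Sum>y\<in>Y_set k s t. oa_weight k s t x y * N y)"
    using N by (auto simp: OAP_eq)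
  have "N \<circ> ?\<sigma> \<in> extensional (Y_set k s t)"
    using Next by (simp add: extensional_def induced_perm_def)
  moreover have "0 \<le> N (?\<sigma> y)" if "y \<in> Y_set k s t" for y
    using Npos that permutes_in_image[OF perm] by blast
  moreover have "0 \<le> oa_const k s t lam x + (\<Sum>y\<in>Y_set k s t. oa_weight k s t x y * N (?\<sigma> y))"
    if x: "x \<in> low_words k s t" for x
  proof -
    let ?x = "word_map k g \<pi> x"
    have xw: "x \<in> words k s" using x by (simp add: low_words_def)
    have x': "?x \<in> low_words k s t"
      using x word_map_in_words[OF assms(1-3)] card_I_set_word_map[OF assms(1-3)] by (simp add: low_words_def)
    have "(\<Sum>y\<in>Y_set k s t. oa_weight k s t x y * N (?\<sigma> y))
        = (\<Sum>y\<in>Y_set k s t. oa_weight k s t ?x (?\<sigma> y) * N (?\<sigma> y))"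
      using oa_weight_word_map[OF assms(1-3) xw]
      by (intro sum.cong refl arg_cong2[where f = "(*)"]) (auto simp: induced_perm_def Y_set_eq)
    also have "\<dots> = (\<Sum>y\<in>Y_set k s t. oa_weight k s t ?x y * N y)"
      using sum.permute[OF perm, of "\<lambda>y. oa_weight k s t ?x y * N y"] by (simp add: o_def)
    finally have "(\<Sum>y\<in>Y_set k s t. oa_weight k s t x y * N (?\<sigma> y))
        = (\<Sum>y\<in>Y_set k s t. oa_weight k s t ?x y * N y)" .
    moreover have "oa_const k s t lam x = oa_const k s t lam ?x"
      using card_I_set_word_map[OF assms(1-3)] by (simp add: oa_const_def)
    ultimately show ?thesis using Nslack x' by simp
  qed
  ultimately show ?thesis by (simp add: OAP_eq)
qed

lemma induced_perm_coord_symmetry: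
  assumes "\<pi> permutes {1..k}" "\<forall>i\<in>{1..k}. g i permutes {2..s}" "1 \<le> s"
  shows "induced_perm k s t g \<pi> \<in> coord_symmetries (Y_set k s t) (OAP k s t lam)"
  using OAP_comp_induced_perm[OF assms] OAP_comp_induced_perm[OF inverse_params[OF assms(1,2)] assms(3)]
  by (intro coord_symmetriesI induced_perm_permutes[OF assms]) (simp_all add: inv_induced_perm[OF assms])

section \<open>Block symmetries are induced by word maps\<close>

context
  fixes k s t :: nat
  assumes s: "2 \<le> s" and t: "0 < t" "t < k" and big: "t + 1 < k \<or> 2 < s"
begin

text \<open>Full words avoid level 1, so two of them at distance \<open>d\<close> share
  \<open>(k - d) choose t\<close> blocks. For \<open>d = 1\<close> this number is nonzero because
  \<open>t \<le> k - 1\<close>, so it characterises adjacency, whereas all distances above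
  \<open>k - t\<close> give 0.\<close>

lemma block_symmetry_on_full_words:
  assumes \<sigma>: "block_symmetry k s t \<sigma>" and "2 < s"
  shows "\<exists>\<pi> g. \<pi> permutes {1..k} \<and> (\<forall>i\<in>{1..k}. g i permutes {2..s}) \<and>
    (\<forall>y\<in>test_words k s. \<sigma> y = word_map k g \<pi> y)"
proof -
  let ?V = "{1..k} \<rightarrow>\<^sub>E {2..s}"
  have V: "test_words k s = ?V"
  proof (intro equalityI subsetI)
    fix y assume "y \<in> test_words k s"
    then have y: "y \<in> words k s" "\<forall>i\<in>{1..k}. y i \<noteq> 1"
      using \<open>2 < s\<close> card_I_set_eq_k[of k y] by (auto simp: test_words_def)
    show "y \<in> ?V"
    proof (rule PiE_I)
      fix i assume i: "i \<in> {1..k}"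
      then show "y i \<in> {2..s}" using words_in[OF y(1) i] y(2) by (auto simp: Ball_def)
    qed (rule words_out[OF y(1)])
  next
    fix y assume y: "y \<in> ?V"
    have yi: "y i \<in> {2..s}" if "i \<in> {1..k}" for i using PiE_mem[OF y that] .
    have "y \<in> words k s"
    proof (rule wordsI)
      fix i assume "i \<in> {1..k}"
      from yi[OF this] show "y i \<in> {1..s}" by simp
    qed (rule PiE_arb[OF y])
    moreover have "\<forall>i\<in>{1..k}. y i \<noteq> 1" using yi by fastforce
    ultimately show "y \<in> test_words k s" using \<open>2 < s\<close> card_I_set_eq_k[of k y] by (simp add: test_words_def)
  qed
  note ctx = s t big
  have sub: "u \<in> Y_set k s t" if "u \<in> ?V" for u using test_words_subset[OF ctx] that V by blast
  have agree: "card {i \<in> {1..k}. u i = v i \<and> u i \<noteq> 1} = k - hdist k u v" if u: "u \<in> ?V" for u v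
  proof -
    have "u i \<noteq> 1" if "i \<in> {1..k}" for i using PiE_mem[OF u that] by simp
    then have "{i \<in> {1..k}. u i = v i \<and> u i \<noteq> 1} = {1..k} - {i \<in> {1..k}. u i \<noteq> v i}" by auto
    moreover have "card ({1..k} - {i \<in> {1..k}. u i \<noteq> v i}) = k - card {i \<in> {1..k}. u i \<noteq> v i}"
      by (subst card_Diff_subset) auto
    ultimately show ?thesis by (simp only: hdist_def)
  qed
  have hdist_le: "hdist k u v \<le> k" for u v
  proof -
    have "hdist k u v \<le> card {1..k}" unfolding hdist_def by (rule card_mono) auto
    then show ?thesis by simp
  qed
  have \<sigma>V: "\<sigma> ` ?V = ?V" using block_symmetry_image_test_words[OF ctx \<sigma>] V by simp
  have choose: "(k - hdist k (\<sigma> u) (\<sigma> v)) choose t = (k - hdist k u v) choose t" if "u \<in> ?V" "v \<in> ?V" for u v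
  proof -
    have "\<sigma> u \<in> ?V" using \<sigma>V that by blast
    then show ?thesis
      using block_symmetry_agreement_choose[OF ctx \<sigma> sub[OF that(1)] sub[OF that(2)]] agree that by simp
  qed
  have tk: "t \<le> k - 1" using t by simp
  have adj: "hdist k (\<sigma> u) (\<sigma> v) = 1 \<longleftrightarrow> hdist k u v = 1" if "u \<in> ?V" "v \<in> ?V" for u v
  proof
    assume "hdist k (\<sigma> u) (\<sigma> v) = 1"
    then have "(k - hdist k u v) choose t = (k - 1) choose t" using choose[OF that] by simp
    then have "k - hdist k u v = k - 1" by (rule binomial_left_inject[OF t(1) tk])
    then show "hdist k u v = 1" using hdist_le[of u v] t by linarith
  next
    assume "hdist k u v = 1"
    then have "(k - hdist k (\<sigma> u) (\<sigma> v)) choose t = (k - 1) choose t" using choose[OF that] by simp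
    then have "k - hdist k (\<sigma> u) (\<sigma> v) = k - 1" by (rule binomial_left_inject[OF t(1) tk])
    then show "hdist k (\<sigma> u) (\<sigma> v) = 1" using hdist_le[of "\<sigma> u" "\<sigma> v"] t by linarith
  qed
  have \<sigma>_bij: "bij_betw \<sigma> ?V ?V"
    using \<sigma>V inj_on_subset[OF permutes_inj[OF block_symmetry_permutes[OF ctx \<sigma>]] subset_UNIV]
    by (simp add: bij_betw_def)
  have levels: "finite {2..s}" "2 \<le> card {2..s}" using \<open>2 < s\<close> by auto
  have "\<forall>u\<in>?V. \<forall>v\<in>?V. hdist k (\<sigma> u) (\<sigma> v) = 1 \<longleftrightarrow> hdist k u v = 1"
    by (intro ballI adj)
  then obtain \<pi> g where "\<pi> permutes {1..k}" "\<forall>i\<in>{1..k}. g i permutes {2..s}"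
    "\<forall>v\<in>?V. \<sigma> v = word_map k g \<pi> v"
    by (rule hamming_automorphism[OF refl \<sigma>_bij _ levels])
  then show ?thesis unfolding V by blast
qed

text \<open>With two levels a word of weight \<open>k - 1\<close> is given by the position of its
  only 1. Every permutation of these words is therefore a permutation of coordinates, with trivial
  level permutations.\<close>

lemma block_symmetry_on_coatoms:
  assumes \<sigma>: "block_symmetry k s t \<sigma>" and "s = 2"
  shows "\<exists>\<pi> g. \<pi> permutes {1..k} \<and> (\<forall>i\<in>{1..k}. g i permutes {2..s}) \<and>
    (\<forall>y\<in>test_words k s. \<sigma> y = word_map k g \<pi> y)"
proof -
  note ctx = s t big
  define c where "c = (\<lambda>l. \<lambda>i\<in>{1..k}. if i = l then 1 else (2 :: nat))"
  have c_apply: "c l i = (if i = l then 1 else 2)" if "i \<in> {1..k}" for l i using that by (simp add: c_def)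
  have c: "test_words k s = c ` {1..k}"
  proof (intro equalityI subsetI)
    fix y assume "y \<in> test_words k s"
    then have y: "y \<in> words k s" "card (I_set k y) = k - 1" using \<open>s = 2\<close> by (auto simp: test_words_def)
    have "card ({1..k} - I_set k y) = 1"
      using y(2) t card_Diff_subset[OF finite_I_set I_set_subset, of k y] by simp
    then obtain l where l: "{1..k} - I_set k y = {l}" by (rule card_1_singletonE)
    have "y = c l"
    proof (rule words_eqI[OF y(1)])
      show "c l \<in> words k s" by (rule wordsI) (auto simp: c_def \<open>s = 2\<close>)
      fix i assume i: "i \<in> {1..k}"
      have "i \<in> I_set k y \<longleftrightarrow> i \<noteq> l" using l i by blast
      then have "y i \<noteq> 1 \<longleftrightarrow> i \<noteq> l" using i by (simp add: I_set_def)
      then show "y i = c l i" using words_in[OF y(1) i] i \<open>s = 2\<close> by (auto simp: c_apply)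
    qed
    moreover have "l \<in> {1..k}" using l by blast
    ultimately show "y \<in> c ` {1..k}" by blast
  next
    fix y assume "y \<in> c ` {1..k}"
    then obtain l where l: "l \<in> {1..k}" "y = c l" by blast
    have "I_set k y = {1..k} - {l}" unfolding l(2) by (auto simp: I_set_def c_def)
    then have "card (I_set k y) = k - 1" using l by simp
    moreover have "y \<in> words k s" unfolding l(2) by (rule wordsI) (auto simp: c_def \<open>s = 2\<close>)
    ultimately show "y \<in> test_words k s" using \<open>s = 2\<close> by (simp add: test_words_def)
  qed
  have c_inj: "inj_on c {1..k}"
  proof (rule inj_onI)
    fix l l' assume l: "l \<in> {1..k}" "l' \<in> {1..k}" "c l = c l'"
    have "c l l = 1" using c_apply[OF l(1), of l] by simp
    then have "c l' l = 1" by (simp only: l(3))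
    moreover have "c l' l = 2" if "l \<noteq> l'" using that c_apply[OF l(1), of l'] by simp
    ultimately show "l = l'" by fastforce
  qed
  have "bij_betw \<sigma> (c ` {1..k}) (c ` {1..k})"
    using block_symmetry_image_test_words[OF ctx \<sigma>]
      inj_on_subset[OF permutes_inj[OF block_symmetry_permutes[OF ctx \<sigma>]] subset_UNIV]
    by (simp add: bij_betw_def c)
  then have "bij_betw (inv_into {1..k} c \<circ> \<sigma> \<circ> c) {1..k} {1..k}"
    using c_inj by (intro bij_betw_trans[of _ _ "c ` {1..k}"] bij_betw_inv_into) (auto simp: bij_betw_def)
  define \<tau> where "\<tau> = (\<lambda>l. if l \<in> {1..k} then (inv_into {1..k} c \<circ> \<sigma> \<circ> c) l else l)"
  have \<tau>: "\<tau> permutes {1..k}"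
  proof (rule bij_imp_permutes)
    show "bij_betw \<tau> {1..k} {1..k}"
      by (rule bij_betw_cong[THEN iffD1, OF _ \<open>bij_betw (inv_into {1..k} c \<circ> \<sigma> \<circ> c) {1..k} {1..k}\<close>])
        (simp add: \<tau>_def)
  qed (auto simp: \<tau>_def)
  have c\<tau>: "c (\<tau> l) = \<sigma> (c l)" if "l \<in> {1..k}" for l
  proof -
    have "\<sigma> (c l) \<in> c ` {1..k}" using block_symmetry_image_test_words[OF ctx \<sigma>] that unfolding c by blast
    then show ?thesis using that by (simp add: \<tau>_def f_inv_into_f)
  qed
  have "\<sigma> (c l) = word_map k (\<lambda>_. id) (inv' \<tau>) (c l)" if l: "l \<in> {1..k}" for l
  proof
    fix i
    show "\<sigma> (c l) i = word_map k (\<lambda>_. id) (inv' \<tau>) (c l) i"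
    proof (cases "i \<in> {1..k}")
      case True
      then have "inv' \<tau> i \<in> {1..k}" by (simp only: permutes_in_image[OF permutes_inv[OF \<tau>]])
      moreover have "i = \<tau> l \<longleftrightarrow> inv' \<tau> i = l" using permutes_inverses[OF \<tau>] by metis
      ultimately show ?thesis using True by (simp add: c\<tau>[OF l, symmetric] word_map_apply c_apply)
    next
      case False
      have "\<sigma> (c l) i = undefined" unfolding c\<tau>[OF l, symmetric] using False by (auto simp: c_def)
      then show ?thesis by (simp only: word_map_out[OF False])
    qed
  qed
  then show ?thesis
    using permutes_inv[OF \<tau>] permutes_id
    by (intro exI[of _ "inv' \<tau>"] exI[of _ "\<lambda>_. id"]) (simp add: c)
qed

theorem coord_symmetries_OAP:
  assumes "1 \<le> lam"
  shows "coord_symmetries (Y_set k s t) (OAP k s t lam) = induced_perms k s t"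
proof (intro equalityI subsetI)
  note ctx = s t big
  fix \<sigma> assume "\<sigma> \<in> coord_symmetries (Y_set k s t) (OAP k s t lam)"
  then have \<sigma>: "block_symmetry k s t \<sigma>"
    using assms by (rule coord_symmetry_imp_block_symmetry[OF ctx])
  obtain \<pi> g where \<pi>: "\<pi> permutes {1..k}" and g: "\<forall>i\<in>{1..k}. g i permutes {2..s}"
    and eq: "\<forall>y\<in>test_words k s. \<sigma> y = word_map k g \<pi> y"
    using block_symmetry_on_full_words[OF \<sigma>] block_symmetry_on_coatoms[OF \<sigma>] s by (metis le_neq_implies_less)
  \<comment> \<open>The induced permutation is itself a symmetry of the polytope, so agreement with
    \<sigma> on the test words is enough for equality.\<close>
  have "block_symmetry k s t (induced_perm k s t g \<pi>)"
    using induced_perm_coord_symmetry[OF \<pi> g] s assms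
    by (intro coord_symmetry_imp_block_symmetry[OF ctx]) auto
  then have "\<sigma> = induced_perm k s t g \<pi>"
    using eq test_words_subset[OF ctx] by (intro block_symmetries_eqI[OF ctx \<sigma>]) (auto simp: induced_perm_def)
  then show "\<sigma> \<in> induced_perms k s t" using \<pi> g by (auto simp: induced_perms_eq)
next
  fix \<sigma> assume "\<sigma> \<in> induced_perms k s t"
  then obtain g \<pi> where "\<pi> permutes {1..k}" "\<forall>i\<in>{1..k}. g i permutes {2..s}" "\<sigma> = induced_perm k s t g \<pi>"
    unfolding induced_perms_eq by blast
  then show "\<sigma> \<in> coord_symmetries (Y_set k s t) (OAP k s t lam)"
    using induced_perm_coord_symmetry[of \<pi> k g s t lam] s by simp
qed

text \<open>Faithfulness of the action, needed for the wreath product. The probes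
  \<open>full a l\<close> have \<open>a\<close> at \<open>l\<close> and 2 elsewhere. If
  \<open>\<pi> i \<noteq> \<rho> i\<close>, taking \<open>l = \<pi> i\<close> gives
  \<open>g i a = h i 2\<close> for every admissible \<open>a\<close>, against injectivity of
  \<open>g i\<close>. Two levels are always admissible: 2 and 3 if \<open>s > 2\<close>, otherwise 1
  and 2, where level 1 lowers the weight to \<open>k - 1\<close> and thus requires
  \<open>t + 1 < k\<close>.\<close>

lemma induced_perm_inject:
  assumes \<pi>: "\<pi> permutes {1..k}" and g: "\<forall>i\<in>{1..k}. g i permutes {2..s}"
    and \<rho>: "\<rho> permutes {1..k}" and h: "\<forall>i\<in>{1..k}. h i permutes {2..s}"
    and eq: "induced_perm k s t g \<pi> = induced_perm k s t h \<rho>"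
  shows "\<pi> = \<rho>" "i \<in> {1..k} \<Longrightarrow> g i = h i"
proof -
  have s1: "1 \<le> s" using s by simp
  have wm: "g i (y (\<pi> i)) = h i (y (\<rho> i))" if "y \<in> Y_set k s t" "i \<in> {1..k}" for y i
    using fun_cong[OF eq, of y] that word_map_apply[OF that(2)] by (metis induced_perm_def)
  define full where "full = (\<lambda>a l. \<lambda>i\<in>{1..k}. if i = l then a else (2 :: nat))"
  have full_apply: "full a l i = (if i = l then a else 2)" if "i \<in> {1..k}" for a l i
    using that by (simp add: full_def)
  have full: "full a l \<in> Y_set k s t" if "a \<in> {1..s}" "a \<noteq> 1 \<or> t + 1 < k" "l \<in> {1..k}" for a l
  proof -
    have "full a l \<in> words k s" using that(1) s by (intro wordsI) (auto simp: full_def)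
    moreover have "{1..k} - {l} \<subseteq> I_set k (full a l)" by (auto simp: full_def I_set_def)
    then have "card ({1..k} - {l}) \<le> card (I_set k (full a l))" by (rule card_mono[OF finite_I_set])
    then have "k - 1 \<le> card (I_set k (full a l))" using that(3) by simp
    moreover have "card (I_set k (full a l)) = k" if "a \<noteq> 1"
      using that by (simp add: card_I_set_eq_k full_def)
    ultimately show ?thesis using that(2) t by (auto simp: Y_set_eq)
  qed
  have "\<pi> i = \<rho> i" for i
  proof (cases "i \<in> {1..k}")
    case i: True
    have \<pi>i: "\<pi> i \<in> {1..k}" and \<rho>i: "\<rho> i \<in> {1..k}"
      using i by (simp_all only: permutes_in_image[OF \<pi>] permutes_in_image[OF \<rho>])
    show ?thesis
    proof (rule ccontr)
      assume ne: "\<pi> i \<noteq> \<rho> i"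
      have val: "g i a = h i 2" if "a \<in> {1..s}" "a \<noteq> 1 \<or> t + 1 < k" for a
        using wm[OF full[OF that \<pi>i] i] ne by (simp add: full_apply[OF \<pi>i] full_apply[OF \<rho>i])
      show False
      proof (cases "2 < s")
        case True
        then have "g i 2 = g i 3" using val[of 2] val[of 3] by simp
        then show False using level_eq_iff[OF \<pi> g s1 i, of 2 3] by simp
      next
        case False
        then have "g i 1 = g i 2" using val[of 1] val[of 2] s big by simp
        then show False using level_eq_iff[OF \<pi> g s1 i, of 1 2] by simp
      qed
    qed
  next
    case False
    then show ?thesis using permutes_not_in[OF \<pi>] permutes_not_in[OF \<rho>] by simp
  qed
  then show \<pi>\<rho>: "\<pi> = \<rho>" by (rule ext)
  assume i: "i \<in> {1..k}"
  have \<pi>i: "\<pi> i \<in> {1..k}" using i by (simp only: permutes_in_image[OF \<pi>])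
  show "g i = h i"
  proof
    fix a
    show "g i a = h i a"
    proof (cases "a \<in> {2..s}")
      case True
      have "full a (\<pi> i) (\<pi> i) = a" using full_apply[OF \<pi>i] by simp
      moreover have "g i (full a (\<pi> i) (\<pi> i)) = h i (full a (\<pi> i) (\<rho> i))"
        using True by (intro wm full \<pi>i i) auto
      ultimately show ?thesis using \<pi>\<rho> by simp
    next
      case False
      then show ?thesis
        using permutes_not_in[OF g[rule_format, OF i]] permutes_not_in[OF h[rule_format, OF i]] by simp
    qed
  qed
qed

end

section \<open>Isomorphism types of the groups of induced and of all permutations\<close>

lemma is_isoI_reverse:
  assumes bij: "bij_betw h (carrier G) (carrier H)"
    and mult: "\<And>x y. x \<in> carrier G \<Longrightarrow> y \<in> carrier G \<Longrightarrow> h (x \<otimes>\<^bsub>G\<^esub> y) = h x \<otimes>\<^bsub>H\<^esub> h y"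
    and closed: "\<And>x y. x \<in> carrier G \<Longrightarrow> y \<in> carrier G \<Longrightarrow> x \<otimes>\<^bsub>G\<^esub> y \<in> carrier G"
  shows "H \<cong> G"
proof -
  \<comment> \<open>The inverse of \<open>h\<close> is multiplicative as soon as products stay in
    the carrier of \<open>G\<close>, where \<open>h\<close> is injective.\<close>
  let ?f = "inv_into (carrier G) h"
  have f: "?f u \<in> carrier G" "h (?f u) = u" if "u \<in> carrier H" for u
    using that bij by (auto simp: bij_betw_def inv_into_into f_inv_into_f)
  have "?f \<in> hom H G"
  proof (rule homI)
    fix u v assume uv: "u \<in> carrier H" "v \<in> carrier H"
    have "u \<otimes>\<^bsub>H\<^esub> v = h (?f u \<otimes>\<^bsub>G\<^esub> ?f v)" using mult f uv by simp
    then show "?f (u \<otimes>\<^bsub>H\<^esub> v) = ?f u \<otimes>\<^bsub>G\<^esub> ?f v"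
      using inv_into_f_f[OF bij_betw_imp_inj_on[OF bij] closed[OF f(1)[OF uv(1)] f(1)[OF uv(2)]]] by simp
  qed (rule f)
  then show ?thesis
    using bij_betw_inv_into[OF bij] unfolding is_iso_def iso_def by blast
qed

lemma map_permutation_bij_betw:
  assumes "bij_betw f A B"
  shows "bij_betw (map_permutation A f) {p. p permutes A} {p. p permutes B}"
proof (rule bij_betw_byWitness[where f' = "map_permutation B (inv_into A f)"])
  have inv: "bij_betw (inv_into A f) B A" by (rule bij_betw_inv_into[OF assms])
  show "\<forall>p\<in>{p. p permutes A}. map_permutation B (inv_into A f) (map_permutation A f p) = p"
    using assms by (auto intro!: map_permutation_compose_inv simp: bij_betw_inv_into_left)
  show "\<forall>p\<in>{p. p permutes B}. map_permutation A f (map_permutation B (inv_into A f) p) = p"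
    using assms inv by (auto intro!: map_permutation_compose_inv simp: bij_betw_inv_into_right)
  show "map_permutation A f ` {p. p permutes A} \<subseteq> {p. p permutes B}"
    using map_permutation_permutes[OF assms] by blast
  show "map_permutation B (inv_into A f) ` {p. p permutes B} \<subseteq> {p. p permutes A}"
    using map_permutation_permutes[OF inv] by blast
qed

lemma perm_group_permutes_iso:
  assumes "finite A" "card A = n"
  shows "perm_group {p. p permutes A} \<cong> sym_group n"
proof -
  obtain f where f: "bij_betw f A {1..n}"
    using bij_betw_iff_card[of A "{1..n}"] assms by auto
  have inj: "inj_on f A" by (rule bij_betw_imp_inj_on[OF f])
  have "map_permutation A f \<in> iso (perm_group {p. p permutes A}) (sym_group n)"
    unfolding iso_def hom_def perm_group_def sym_group_def
    using map_permutation_bij_betw[OF f] map_permutation_permutes[OF f] map_permutation_compose'[OF inj]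
    by auto
  then show ?thesis unfolding is_iso_def by blast
qed

text \<open>As \<open>word_map\<close> reverses the order of position permutations, the pair
  \<open>(g, \<pi>)\<close> has to act through \<open>inv' \<pi>\<close>. The shift
  \<open>h (inv' \<pi> i)\<close> in the product of \<open>wreath_sym\<close> is then exactly the
  one in \<open>word_map_comp\<close>.\<close>

lemma perm_group_induced_perms_iso:
  assumes s: "2 \<le> s" and t: "0 < t" "t < k" and big: "t + 1 < k \<or> 2 < s"
  shows "perm_group (induced_perms k s t) \<cong> wreath_sym (sym_group (s - 1)) k"
proof (rule is_isoI_reverse)
  have s1: "1 \<le> s" using s by simp
  let ?G = "wreath_sym (sym_group (s - 1)) k"
  \<comment> \<open>\<open>sym_group (s - 1)\<close> lives on \<open>{1..s - 1}\<close>, the movable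
    levels are \<open>{2..s}\<close>, and \<open>Suc\<close> translates between them.\<close>
  define lift where "lift = map_permutation {1..s - 1} Suc"
  have Suc_bij: "bij_betw Suc {1..s - 1} {2..s}"
  proof -
    have "Suc ` {1..s - 1} = {2..s}" using s by (simp add: image_Suc_atLeastAtMost numeral_2_eq_2)
    then show ?thesis by (simp add: bij_betw_def)
  qed
  have lift_bij: "bij_betw lift {p. p permutes {1..s - 1}} {p. p permutes {2..s}}"
    unfolding lift_def by (rule map_permutation_bij_betw[OF Suc_bij])
  have lift_perm: "lift p permutes {2..s}" if "p permutes {1..s - 1}" for p
    using bij_betwE[OF lift_bij] that by blast
  have lift_comp: "lift (p \<circ> q) = lift p \<circ> lift q" if "q permutes {1..s - 1}" for p q
    unfolding lift_def by (rule map_permutation_compose'[OF bij_betw_imp_inj_on[OF Suc_bij] that])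
  define \<Phi> where "\<Phi> = (\<lambda>(g :: nat \<Rightarrow> nat \<Rightarrow> nat, \<pi>). induced_perm k s t (\<lambda>i. lift (g i)) (inv' \<pi>))"
  have in_G: "(g, \<pi>) \<in> carrier ?G \<longleftrightarrow>
      g \<in> {1..k} \<rightarrow>\<^sub>E {p. p permutes {1..s - 1}} \<and> \<pi> permutes {1..k}" for g \<pi>
    by (simp add: wreath_sym_def sym_group_def)
  have mult_G: "(g, \<pi>) \<otimes>\<^bsub>?G\<^esub> (h, \<rho>) = (\<lambda>i\<in>{1..k}. g i \<circ> h (inv' \<pi> i), \<pi> \<circ> \<rho>)" for g \<pi> h \<rho>
    by (simp add: wreath_sym_def sym_group_def)
  have params: "inv' \<pi> permutes {1..k}" "\<forall>i\<in>{1..k}. lift (g i) permutes {2..s}"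
    if "(g, \<pi>) \<in> carrier ?G" for g \<pi>
  proof -
    have g: "g \<in> {1..k} \<rightarrow>\<^sub>E {p. p permutes {1..s - 1}}" and \<pi>: "\<pi> permutes {1..k}"
      using that by (auto simp only: in_G)
    show "inv' \<pi> permutes {1..k}" by (rule permutes_inv[OF \<pi>])
    show "\<forall>i\<in>{1..k}. lift (g i) permutes {2..s}" using lift_perm PiE_mem[OF g] by blast
  qed
  have closed: "(g, \<pi>) \<otimes>\<^bsub>?G\<^esub> (h, \<rho>) \<in> carrier ?G"
    if "(g, \<pi>) \<in> carrier ?G" "(h, \<rho>) \<in> carrier ?G" for g \<pi> h \<rho>
  proof -
    have g: "g \<in> {1..k} \<rightarrow>\<^sub>E {p. p permutes {1..s - 1}}" and \<pi>: "\<pi> permutes {1..k}"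
      and h: "h \<in> {1..k} \<rightarrow>\<^sub>E {p. p permutes {1..s - 1}}" and \<rho>: "\<rho> permutes {1..k}"
      using that by (auto simp only: in_G)
    have "g i \<circ> h (inv' \<pi> i) \<in> {p. p permutes {1..s - 1}}" if i: "i \<in> {1..k}" for i
    proof -
      have "inv' \<pi> i \<in> {1..k}" using i by (simp only: permutes_in_image[OF permutes_inv[OF \<pi>]])
      then show ?thesis using PiE_mem[OF g i] PiE_mem[OF h] permutes_compose by blast
    qed
    then show ?thesis
      unfolding mult_G in_G using permutes_compose[OF \<rho> \<pi>] by (intro conjI restrict_PiE_iff[THEN iffD2] ballI)
  qed
  then show "\<And>x y. x \<in> carrier ?G \<Longrightarrow> y \<in> carrier ?G \<Longrightarrow> x \<otimes>\<^bsub>?G\<^esub> y \<in> carrier ?G" by force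
  have "\<Phi> ((g, \<pi>) \<otimes>\<^bsub>?G\<^esub> (h, \<rho>)) = \<Phi> (g, \<pi>) \<circ> \<Phi> (h, \<rho>)"
    if G: "(g, \<pi>) \<in> carrier ?G" and H: "(h, \<rho>) \<in> carrier ?G" for g \<pi> h \<rho>
  proof
    have h: "h \<in> {1..k} \<rightarrow>\<^sub>E {p. p permutes {1..s - 1}}" and \<pi>: "\<pi> permutes {1..k}" and \<rho>: "\<rho> permutes {1..k}"
      using G H by (auto simp only: in_G)
    have inv: "inv' (\<pi> \<circ> \<rho>) = inv' \<rho> \<circ> inv' \<pi>"
      by (rule o_inv_distrib[OF permutes_bij[OF \<pi>] permutes_bij[OF \<rho>]])
    fix y
    show "\<Phi> ((g, \<pi>) \<otimes>\<^bsub>?G\<^esub> (h, \<rho>)) y = (\<Phi> (g, \<pi>) \<circ> \<Phi> (h, \<rho>)) y"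
    proof (cases "y \<in> Y_set k s t")
      case True
      have "\<Phi> ((g, \<pi>) \<otimes>\<^bsub>?G\<^esub> (h, \<rho>)) y
          = word_map k (\<lambda>i. lift ((\<lambda>i\<in>{1..k}. g i \<circ> h (inv' \<pi> i)) i)) (inv' \<rho> \<circ> inv' \<pi>) y"
        using True by (simp only: \<Phi>_def mult_G case_prod_conv induced_perm_def if_True inv)
      also have "\<dots> = word_map k (\<lambda>i. lift (g i) \<circ> lift (h (inv' \<pi> i))) (inv' \<rho> \<circ> inv' \<pi>) y"
      proof (rule word_map_cong)
        fix i assume i: "i \<in> {1..k}"
        have "inv' \<pi> i \<in> {1..k}" using i by (simp only: permutes_in_image[OF permutes_inv[OF \<pi>]])
        then have "h (inv' \<pi> i) permutes {1..s - 1}" using PiE_mem[OF h] by blast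
        then show "lift ((\<lambda>i\<in>{1..k}. g i \<circ> h (inv' \<pi> i)) i) = lift (g i) \<circ> lift (h (inv' \<pi> i))"
          using i by (simp only: restrict_apply if_True lift_comp)
      qed
      also have "\<dots> = word_map k (\<lambda>i. lift (g i)) (inv' \<pi>) (word_map k (\<lambda>i. lift (h i)) (inv' \<rho>) y)"
        by (rule word_map_comp[OF permutes_inv[OF \<pi>], symmetric])
      also have "\<dots> = (\<Phi> (g, \<pi>) \<circ> \<Phi> (h, \<rho>)) y"
        using True word_map_in_Y_set[OF params[OF H] s1 True] by (simp add: \<Phi>_def induced_perm_def)
      finally show ?thesis .
    next
      case False
      then show ?thesis by (simp only: \<Phi>_def mult_G case_prod_conv induced_perm_def o_apply if_False)
    qed
  qed
  then show "\<And>x y. x \<in> carrier ?G \<Longrightarrow> y \<in> carrier ?G \<Longrightarrow>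
      \<Phi> (x \<otimes>\<^bsub>?G\<^esub> y) = \<Phi> x \<otimes>\<^bsub>perm_group (induced_perms k s t)\<^esub> \<Phi> y"
    by (force simp: perm_group_def)
  have "inj_on \<Phi> (carrier ?G)"
  proof (rule inj_onI, clarify)
    fix g \<pi> h \<rho> assume G: "(g, \<pi>) \<in> carrier ?G" and H: "(h, \<rho>) \<in> carrier ?G" and eq: "\<Phi> (g, \<pi>) = \<Phi> (h, \<rho>)"
    have g: "g \<in> {1..k} \<rightarrow>\<^sub>E {p. p permutes {1..s - 1}}" and \<pi>: "\<pi> permutes {1..k}"
      and h: "h \<in> {1..k} \<rightarrow>\<^sub>E {p. p permutes {1..s - 1}}" and \<rho>: "\<rho> permutes {1..k}"
      using G H by (auto simp only: in_G)
    note inj = induced_perm_inject[OF s t big params[OF G] params[OF H] eq[unfolded \<Phi>_def case_prod_conv]]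
    have "\<pi> = \<rho>" using inj(1) inv_inv_eq[OF permutes_bij] \<pi> \<rho> by metis
    moreover have "g = h"
    proof (rule PiE_ext[OF g h])
      fix i assume i: "i \<in> {1..k}"
      show "g i = h i"
        by (rule inj_onD[OF bij_betw_imp_inj_on[OF lift_bij] inj(2)[OF i] PiE_mem[OF g i] PiE_mem[OF h i]])
    qed
    ultimately show "g = h \<and> \<pi> = \<rho>" by simp
  qed
  moreover have "\<Phi> ` carrier ?G = induced_perms k s t"
  proof (intro equalityI subsetI)
    fix \<sigma> assume "\<sigma> \<in> \<Phi> ` carrier ?G"
    then obtain g \<pi> where G: "(g, \<pi>) \<in> carrier ?G" and \<sigma>: "\<sigma> = \<Phi> (g, \<pi>)" by force
    show "\<sigma> \<in> induced_perms k s t"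
      unfolding \<sigma> \<Phi>_def case_prod_conv induced_perms_eq using params[OF G] by blast
  next
    fix \<sigma> assume "\<sigma> \<in> induced_perms k s t"
    then obtain g \<pi> where \<pi>: "\<pi> permutes {1..k}" and g: "\<forall>i\<in>{1..k}. g i permutes {2..s}"
      and \<sigma>: "\<sigma> = induced_perm k s t g \<pi>"
      unfolding induced_perms_eq by blast
    define g' where "g' = (\<lambda>i\<in>{1..k}. inv_into {p. p permutes {1..s - 1}} lift (g i))"
    have g'_lift: "lift (inv_into {p. p permutes {1..s - 1}} lift (g i)) = g i"
      and g'_perm: "inv_into {p. p permutes {1..s - 1}} lift (g i) \<in> {p. p permutes {1..s - 1}}"
      if "i \<in> {1..k}" for i
    proof -
      have "g i \<in> lift ` {p. p permutes {1..s - 1}}"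
        using bij_betw_imp_surj_on[OF lift_bij] g that by blast
      then show "lift (inv_into {p. p permutes {1..s - 1}} lift (g i)) = g i"
        "inv_into {p. p permutes {1..s - 1}} lift (g i) \<in> {p. p permutes {1..s - 1}}"
        by (rule f_inv_into_f, rule inv_into_into)
    qed
    have "(g', inv' \<pi>) \<in> carrier ?G"
      unfolding in_G g'_def using permutes_inv[OF \<pi>] g'_perm by (intro conjI restrict_PiE_iff[THEN iffD2] ballI)
    moreover have "\<sigma> = \<Phi> (g', inv' \<pi>)"
    proof -
      have "word_map k g \<pi> y = word_map k (\<lambda>i. lift (g' i)) \<pi> y" for y
        by (rule word_map_cong) (simp only: g'_def restrict_apply if_True g'_lift)
      moreover have "inv' (inv' \<pi>) = \<pi>" by (rule permutes_inv_inv[OF \<pi>])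
      ultimately show ?thesis by (simp only: \<sigma> \<Phi>_def case_prod_conv induced_perm_def)
    qed
    ultimately show "\<sigma> \<in> \<Phi> ` carrier ?G" by blast
  qed
  ultimately show "bij_betw \<Phi> (carrier ?G) (carrier (perm_group (induced_perms k s t)))"
    by (simp add: bij_betw_def perm_group_def)
qed

section \<open>Strength zero and the cases with trivial symmetry group\<close>

lemma id_in_coord_symmetries: "id \<in> coord_symmetries Y P"
  by (simp add: coord_symmetries_def permutes_id)

text \<open>For \<open>t = 0\<close> a low word has empty support, so all its coefficients are -1
  and its constraint involves only the total sum of \<open>N\<close>.\<close>

lemma coord_symmetries_strength_0:
  "coord_symmetries (Y_set k s 0) (OAP k s 0 lam) = {\<sigma>. \<sigma> permutes Y_set k s 0}"
proof (intro equalityI subsetI)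
  have inv: "N \<circ> \<sigma> \<in> OAP k s 0 lam" if \<sigma>: "\<sigma> permutes Y_set k s 0" and N: "N \<in> OAP k s 0 lam" for N \<sigma>
  proof -
    have w: "oa_weight k s 0 x y = - 1" if "x \<in> low_words k s 0" "y \<in> Y_set k s 0" for x y
      using that by (simp add: low_words_def oa_weight_def J_set_def Y_set_eq)
    have "(\<Sum>y\<in>Y_set k s 0. oa_weight k s 0 x y * N (\<sigma> y)) = (\<Sum>y\<in>Y_set k s 0. oa_weight k s 0 x y * N y)"
      if "x \<in> low_words k s 0" for x
      using sum.permute[OF \<sigma>, of N] by (simp add: w[OF that] sum_negf o_def cong: sum.cong)
    moreover have "N \<circ> \<sigma> \<in> extensional (Y_set k s 0)"
      using N permutes_not_in[OF \<sigma>] by (simp add: OAP_eq extensional_def)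
    moreover have "0 \<le> N (\<sigma> y)" if "y \<in> Y_set k s 0" for y
      using N that permutes_in_image[OF \<sigma>] by (simp add: OAP_eq)
    ultimately show ?thesis using N by (simp add: OAP_eq)
  qed
  show "\<sigma> \<in> coord_symmetries (Y_set k s 0) (OAP k s 0 lam)" if "\<sigma> \<in> {\<sigma>. \<sigma> permutes Y_set k s 0}" for \<sigma>
    using that inv permutes_inv by (intro coord_symmetriesI) auto
qed (simp add: coord_symmetries_def)

lemma card_Y_set_0:
  assumes "1 \<le> s"
  shows "card (Y_set k s 0) = s ^ k - 1"
proof -
  have ones: "ones k \<in> words k s" using assms by (intro wordsI) (auto simp: ones_def)
  have "card (I_set k x) = 0 \<longleftrightarrow> x = ones k" if "x \<in> words k s" for x
  proof
    assume "card (I_set k x) = 0"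
    then have "x i = ones k i" if "i \<in> {1..k}" for i using that by (auto simp: I_set_def ones_def)
    then show "x = ones k" by (rule words_eqI[OF that ones])
  qed (simp add: I_set_def ones_def)
  then have "Y_set k s 0 = words k s - {ones k}" using ones by (auto simp only: Y_set_eq neq0_conv[symmetric])
  moreover have "card (words k s) = s ^ k" by (simp add: words_def card_PiE)
  ultimately show ?thesis using ones by simp
qed

text \<open>For \<open>t = k\<close> no word is heavy enough. For \<open>k = t + 1\<close> only
  weight \<open>k\<close> remains, and with two levels this leaves the all-2 word. The identity is
  then the only permutation of \<open>Y_set\<close>.\<close>

lemma Y_set_subset_singleton:
  assumes "t = k \<or> k = t + 1 \<and> s = 2"
  shows "Y_set k s t \<subseteq> {\<lambda>i\<in>{1..k}. 2}"
proof
  fix y assume y: "y \<in> Y_set k s t"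
  then have yw: "y \<in> words k s" and "k = t + 1" "s = 2" "card (I_set k y) = k"
    using assms card_I_set_le[of k y] by (auto simp: Y_set_eq)
  then have ne: "\<forall>i\<in>{1..k}. y i \<noteq> 1" by (simp only: card_I_set_eq_k)
  have "y = (\<lambda>i\<in>{1..k}. 2)"
  proof (rule words_eqI[OF yw])
    show "(\<lambda>i\<in>{1..k}. 2) \<in> words k s" by (rule wordsI) (auto simp: \<open>s = 2\<close>)
    fix i assume i: "i \<in> {1..k}"
    then have "y i \<noteq> 1" using ne by blast
    then show "y i = (\<lambda>i\<in>{1..k}. 2) i" using words_in[OF yw i] i \<open>s = 2\<close> by auto
  qed
  then show "y \<in> {\<lambda>i\<in>{1..k}. 2}" by simp
qed

theorem theorem12:
  fixes s k t :: nat and lam :: int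
  assumes "s \<ge> 2" and "k \<ge> 1" and "t \<le> k" and "lam \<ge> 1"
  shows "coord_symmetries (Y_set k s t) (OAP k s t lam) = H_perms k s t
    \<and> (t = 0 \<longrightarrow> perm_group (H_perms k s t) \<cong> sym_group (s ^ k - 1))
    \<and> (0 < t \<and> t < k \<and> (k > t + 1 \<or> s > 2) \<longrightarrow>
         perm_group (H_perms k s t) \<cong> wreath_sym (sym_group (s - 1)) k)"
proof -
  consider "t = 0" | "0 < t" "t < k" "t + 1 < k \<or> 2 < s" | "0 < t" "t = k \<or> k = t + 1 \<and> s = 2"
    using assms by linarith
  then show ?thesis
  proof cases
    case 1
    then show ?thesis
      using assms perm_group_permutes_iso[OF finite_Y_set card_Y_set_0]
      by (simp add: H_perms_def coord_symmetries_strength_0)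
  next
    case 2
    then show ?thesis
      using assms coord_symmetries_OAP[of s t k lam] perm_group_induced_perms_iso[of s t k]
      by (simp add: H_perms_def)
  next
    case 3
    have "\<sigma> = id" if "\<sigma> permutes Y_set k s t" for \<sigma>
      using permutes_subset[OF that Y_set_subset_singleton[OF 3(2)]] by simp
    then have "coord_symmetries (Y_set k s t) (OAP k s t lam) = {id}"
      using id_in_coord_symmetries by (auto simp: coord_symmetries_def)
    then show ?thesis using 3 by (auto simp: H_perms_def)
  qed
qed

end
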